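(* Let $F$ be a field with $|F|\ge 4$. Let $f$ be the homomorphism \[ f:\ \langle [x]+[x^{-1}] : x\in F^\flat\rangle\ \longrightarrow\ \langle x\overset{\sigma}{\otimes}(-x) : x\in F^\flat\rangle \] from the subgroup of $\mathfrak p(F)/\langle c_F\rangle$ generated by the classes of $[x]+[x^{-1}]$ to the subgroup of $(F^\times\otimes F^\times)_\sigma$ generated by the elements $x\overset{\sigma}{\otimes}(-x)$, obtained by restricting the map $\mathfrak p(F)/\langle c_F\rangle\to(F^\times\otimes F^\times)_\sigma$, $[x]\mapsto x\overset{\sigma}{\otimes}(1-x)$. Then $f$ is bijective. In particular, the natural map $\mathfrak p(F)/\langle c_F\rangle\to\overline{\mathfrak p}(F)$, $[x]\mapsto[x]$, induces an isomorphism $B(F)/\langle c_F\rangle\to\overline B(F)$.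
   Context: For a field $F$ put $F^\flat=F\setminus\{0,1\}$ and let $\mathbb Z[F^\flat]$ be the free abelian group on symbols $[x]$, $x\in F^\flat$. Suslin's groups (for $|F|\ge4$): $\mathfrak p(F)$ is the quotient of $\mathbb Z[F^\flat]$ by the subgroup generated by all $[x]-[y]+\bigl[\frac yx\bigr]+\bigl[\frac{1-x}{1-y}\bigr]-\bigl[\frac{1-x^{-1}}{1-y^{-1}}\bigr]$ with $x\ne y$ in $F^\flat$; $(F^\times\otimes F^\times)_\sigma=F^\times\otimes F^\times/\langle x\otimes y+y\otimes x : x,y\in F^\times\rangle$, with $a\overset{\sigma}{\otimes}b$ the class of $a\otimes b$; $B(F)$ is the kernel of $\mathfrak p(F)\to(F^\times\otimes F^\times)_\sigma$, $[x]\mapsto x\overset{\sigma}{\otimes}(1-x)$. The element $c_F=[x]+[1-x]\in B(F)$ is independent of $x\in F^\flat$. Modified groups: $\widetilde\wedge^2F^\times=F^\times\otimes_{\mathbb Z}F^\times/\langle(-x)\otimes x : x\in F^\times\rangle$, with $a\,\tilde\wedge\,b$ the class of $a\otimes b$; $\overline{\mathfrak p}(F)$ is the quotient of $\mathbb Z[F^\flat]$ by the subgroup generated by all $[x]-[y]+[y/x]-[(1-y)/(1-x)]+[(1-y^{-1})/(1-x^{-1})]$ ($x\neq y$ in $F^\flat$) and all $[x]+[x^{-1}]$, $[y]+[1-y]$ ($x,y\in F^\flat$). Thus $\overline{\mathfrak p}(F)$ is the quotient of $\mathfrak p(F)/\langle c_F\rangle$ by the subgroup generated by all $[x]+[x^{-1}]$,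 and $\widetilde\wedge^2F^\times$ is the quotient of $(F^\times\otimes F^\times)_\sigma$ by the subgroup generated by all $x\overset{\sigma}{\otimes}(-x)$. $\overline B(F)$ is the kernel of $\partial_{2,F}:\overline{\mathfrak p}(F)\to\widetilde\wedge^2F^\times$, $[x]\mapsto(1-x)\,\tilde\wedge\,x$. *)

theory Defs
  imports
    "HOL-Algebra.Free_Abelian_Groups"
    "HOL-Algebra.Algebraic_Closure_Type"
begin

section \<open>Quotients and tensor products of abelian groups\<close>

definition quotient_by :: "('g, 'm) monoid_scheme \<Rightarrow> 'g set \<Rightarrow> 'g set monoid" where
  "quotient_by G S = G Mod generate G S"

definition quotient_class :: "('g, 'm) monoid_scheme \<Rightarrow> 'g set \<Rightarrow> 'g \<Rightarrow> 'g set" where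
  "quotient_class G S x = generate G S #>\<^bsub>G\<^esub> x"

text \<open>
  The map that \<open>h\<close> induces on a quotient of its domain. It is meaningful only if \<open>h\<close> is a
  homomorphism that is trivial on the subgroup divided out: \<open>h\<close> is then constant on each
  coset \<open>C\<close>, and \<open>h ` C\<close> is a singleton.
\<close>
definition induced_map :: "('g \<Rightarrow> 'h) \<Rightarrow> 'g set \<Rightarrow> 'h" where
  "induced_map h C = the_elem (h ` C)"

text \<open>The homomorphism from a free abelian group to \<open>G\<close> that sends each basis element \<open>x\<close> to \<open>f x\<close>.\<close>
definition free_ext :: "('g, 'm) monoid_scheme \<Rightarrow> ('b \<Rightarrow> 'g) \<Rightarrow> ('b \<Rightarrow>\<^sub>0 int) \<Rightarrow> 'g" where
  "free_ext G f c =
     finprod G (\<lambda>x. f x [^]\<^bsub>G\<^esub> Poly_Mapping.lookup c x) (Poly_Mapping.keys c)"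

definition tensor_relators ::
  "('g, 'm) monoid_scheme \<Rightarrow> ('h, 'n) monoid_scheme \<Rightarrow> ('g \<times> 'h \<Rightarrow>\<^sub>0 int) set" where
  "tensor_relators G H =
     {frag_of (x \<otimes>\<^bsub>G\<^esub> x', y) - frag_of (x, y) - frag_of (x', y) | x x' y.
        x \<in> carrier G \<and> x' \<in> carrier G \<and> y \<in> carrier H} \<union>
     {frag_of (x, y \<otimes>\<^bsub>H\<^esub> y') - frag_of (x, y) - frag_of (x, y') | x y y'.
        x \<in> carrier G \<and> y \<in> carrier H \<and> y' \<in> carrier H}"

definition tensor ::
  "('g, 'm) monoid_scheme \<Rightarrow> ('h, 'n) monoid_scheme \<Rightarrow> ('g \<times> 'h \<Rightarrow>\<^sub>0 int) set monoid" where
  "tensor G H = quotient_by (free_Abelian_group (carrier G \<times> carrier H)) (tensor_relators G H)"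

definition pure_tensor ::
  "('g, 'm) monoid_scheme \<Rightarrow> ('h, 'n) monoid_scheme \<Rightarrow> 'g \<Rightarrow> 'h \<Rightarrow> ('g \<times> 'h \<Rightarrow>\<^sub>0 int) set" where
  "pure_tensor G H x y =
     quotient_class (free_Abelian_group (carrier G \<times> carrier H)) (tensor_relators G H) (frag_of (x, y))"


section \<open>The field and its tensor squares\<close>

text \<open>
  The field is a type \<open>'a\<close> of class \<^class>\<open>field\<close>. The argument \<open>F :: 'a itself\<close> below carries
  no information; it only makes the dependence on the field explicit. All abelian groups are
  \<open>HOL-Algebra\<close> groups, hence written multiplicatively, except that elements of free abelian
  groups are finitely supported functions with pointwise \<open>+\<close> and \<open>-\<close>.
\<close>

definition Fflat :: "'a::field itself \<Rightarrow> 'a set" where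
  "Fflat F = UNIV - {0, 1}"

definition Funits :: "'a::field itself \<Rightarrow> 'a monoid" where
  "Funits F = units_of (ring_of_type_algebra :: 'a ring)"

definition tensor_square :: "'a::field itself \<Rightarrow> ('a \<times> 'a \<Rightarrow>\<^sub>0 int) set monoid" where
  "tensor_square F = tensor (Funits F) (Funits F)"

definition tens :: "'a::field itself \<Rightarrow> 'a \<Rightarrow> 'a \<Rightarrow> ('a \<times> 'a \<Rightarrow>\<^sub>0 int) set" where
  "tens F x y = pure_tensor (Funits F) (Funits F) x y"

definition sigma_relators :: "'a::field itself \<Rightarrow> ('a \<times> 'a \<Rightarrow>\<^sub>0 int) set set" where
  "sigma_relators F =
     {tens F x y \<otimes>\<^bsub>tensor_square F\<^esub> tens F y x | x y.
        x \<in> carrier (Funits F) \<and> y \<in> carrier (Funits F)}"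

definition tensor_sigma :: "'a::field itself \<Rightarrow> ('a \<times> 'a \<Rightarrow>\<^sub>0 int) set set monoid" where
  "tensor_sigma F = quotient_by (tensor_square F) (sigma_relators F)"

definition tens_sigma :: "'a::field itself \<Rightarrow> 'a \<Rightarrow> 'a \<Rightarrow> ('a \<times> 'a \<Rightarrow>\<^sub>0 int) set set" where
  "tens_sigma F x y = quotient_class (tensor_square F) (sigma_relators F) (tens F x y)"

definition wedge_relators :: "'a::field itself \<Rightarrow> ('a \<times> 'a \<Rightarrow>\<^sub>0 int) set set" where
  "wedge_relators F = {tens F (- x) x | x. x \<in> carrier (Funits F)}"

definition wedge_square :: "'a::field itself \<Rightarrow> ('a \<times> 'a \<Rightarrow>\<^sub>0 int) set set monoid" where
  "wedge_square F = quotient_by (tensor_square F) (wedge_relators F)"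

definition wedge :: "'a::field itself \<Rightarrow> 'a \<Rightarrow> 'a \<Rightarrow> ('a \<times> 'a \<Rightarrow>\<^sub>0 int) set set" where
  "wedge F x y = quotient_class (tensor_square F) (wedge_relators F) (tens F x y)"


section \<open>Suslin's groups\<close>

definition suslin_relators :: "'a::field itself \<Rightarrow> ('a \<Rightarrow>\<^sub>0 int) set" where
  "suslin_relators F =
     {frag_of x - frag_of y + frag_of (y / x) + frag_of ((1 - x) / (1 - y))
        - frag_of ((1 - inverse x) / (1 - inverse y)) | x y.
        x \<in> Fflat F \<and> y \<in> Fflat F \<and> x \<noteq> y}"

definition pre_bloch :: "'a::field itself \<Rightarrow> ('a \<Rightarrow>\<^sub>0 int) set monoid" where
  "pre_bloch F = quotient_by (free_Abelian_group (Fflat F)) (suslin_relators F)"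

definition bloch_sym :: "'a::field itself \<Rightarrow> 'a \<Rightarrow> ('a \<Rightarrow>\<^sub>0 int) set" where
  "bloch_sym F x = quotient_class (free_Abelian_group (Fflat F)) (suslin_relators F) (frag_of x)"

definition suslin_map ::
  "'a::field itself \<Rightarrow> ('a \<Rightarrow>\<^sub>0 int) set \<Rightarrow> ('a \<times> 'a \<Rightarrow>\<^sub>0 int) set set" where
  "suslin_map F = induced_map (free_ext (tensor_sigma F) (\<lambda>x. tens_sigma F x (1 - x)))"

definition bloch :: "'a::field itself \<Rightarrow> ('a \<Rightarrow>\<^sub>0 int) set monoid" where
  "bloch F = (pre_bloch F)\<lparr>carrier := kernel (pre_bloch F) (tensor_sigma F) (suslin_map F)\<rparr>"

text \<open>For \<open>|F| \<ge> 4\<close> the value does not depend on the chosen \<open>x\<close>.\<close>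
definition c_elem :: "'a::field itself \<Rightarrow> ('a \<Rightarrow>\<^sub>0 int) set" where
  "c_elem F = (let x = SOME x. x \<in> Fflat F in bloch_sym F x \<otimes>\<^bsub>pre_bloch F\<^esub> bloch_sym F (1 - x))"

definition pre_bloch_mod_c :: "'a::field itself \<Rightarrow> ('a \<Rightarrow>\<^sub>0 int) set set monoid" where
  "pre_bloch_mod_c F = quotient_by (pre_bloch F) {c_elem F}"

definition bloch_sym_mod_c :: "'a::field itself \<Rightarrow> 'a \<Rightarrow> ('a \<Rightarrow>\<^sub>0 int) set set" where
  "bloch_sym_mod_c F x = quotient_class (pre_bloch F) {c_elem F} (bloch_sym F x)"

definition suslin_map_mod_c ::
  "'a::field itself \<Rightarrow> ('a \<Rightarrow>\<^sub>0 int) set set \<Rightarrow> ('a \<times> 'a \<Rightarrow>\<^sub>0 int) set set" where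
  "suslin_map_mod_c F = induced_map (suslin_map F)"

text \<open>
  Cosets in \<^term>\<open>bloch F\<close> are computed as in \<^term>\<open>pre_bloch F\<close>, so the elements of this group
  are literally elements of \<^term>\<open>pre_bloch_mod_c F\<close>.
\<close>
definition bloch_mod_c :: "'a::field itself \<Rightarrow> ('a \<Rightarrow>\<^sub>0 int) set set monoid" where
  "bloch_mod_c F = quotient_by (bloch F) {c_elem F}"


section \<open>The modified groups\<close>

definition bar_relators :: "'a::field itself \<Rightarrow> ('a \<Rightarrow>\<^sub>0 int) set" where
  "bar_relators F =
     {frag_of x - frag_of y + frag_of (y / x) - frag_of ((1 - y) / (1 - x))
        + frag_of ((1 - inverse y) / (1 - inverse x)) | x y.
        x \<in> Fflat F \<and> y \<in> Fflat F \<and> x \<noteq> y} \<union>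
     {frag_of x + frag_of (inverse x) | x. x \<in> Fflat F} \<union>
     {frag_of y + frag_of (1 - y) | y. y \<in> Fflat F}"

definition pre_bloch_bar :: "'a::field itself \<Rightarrow> ('a \<Rightarrow>\<^sub>0 int) set monoid" where
  "pre_bloch_bar F = quotient_by (free_Abelian_group (Fflat F)) (bar_relators F)"

definition bloch_sym_bar :: "'a::field itself \<Rightarrow> 'a \<Rightarrow> ('a \<Rightarrow>\<^sub>0 int) set" where
  "bloch_sym_bar F x = quotient_class (free_Abelian_group (Fflat F)) (bar_relators F) (frag_of x)"

definition boundary_bar ::
  "'a::field itself \<Rightarrow> ('a \<Rightarrow>\<^sub>0 int) set \<Rightarrow> ('a \<times> 'a \<Rightarrow>\<^sub>0 int) set set" where
  "boundary_bar F = induced_map (free_ext (wedge_square F) (\<lambda>x. wedge F (1 - x) x))"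

definition bloch_bar :: "'a::field itself \<Rightarrow> ('a \<Rightarrow>\<^sub>0 int) set monoid" where
  "bloch_bar F =
     (pre_bloch_bar F)\<lparr>carrier := kernel (pre_bloch_bar F) (wedge_square F) (boundary_bar F)\<rparr>"


section \<open>The two maps of the theorem\<close>

definition inversion_subgroup :: "'a::field itself \<Rightarrow> ('a \<Rightarrow>\<^sub>0 int) set set monoid" where
  "inversion_subgroup F =
     subgroup_generated (pre_bloch_mod_c F)
       {bloch_sym_mod_c F x \<otimes>\<^bsub>pre_bloch_mod_c F\<^esub> bloch_sym_mod_c F (inverse x) | x. x \<in> Fflat F}"

definition negation_subgroup :: "'a::field itself \<Rightarrow> ('a \<times> 'a \<Rightarrow>\<^sub>0 int) set set monoid" where
  "negation_subgroup F =
     subgroup_generated (tensor_sigma F) {tens_sigma F x (- x) | x. x \<in> Fflat F}"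

text \<open>
  Induced twice: the map on the free abelian group descends to \<^term>\<open>pre_bloch F\<close> and then to
  \<^term>\<open>pre_bloch_mod_c F\<close>.
\<close>
definition natural_map ::
  "'a::field itself \<Rightarrow> ('a \<Rightarrow>\<^sub>0 int) set set \<Rightarrow> ('a \<Rightarrow>\<^sub>0 int) set" where
  "natural_map F = induced_map (induced_map (free_ext (pre_bloch_bar F) (bloch_sym_bar F)))"

end

theory Submission
  imports Defs
begin

text \<open>
  Write \<open>\<langle>x\<rangle> = [x] + [x\<inverse>]\<close> for an inversion sum, with \<open>\<langle>1\<rangle> = 0\<close>. The homomorphism \<open>f\<close> sends
  \<open>\<langle>x\<rangle>\<close> to \<open>x \<otimes> (-x)\<close>, because \<open>1 - x\<inverse> = (1 - x) / (-x)\<close>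
  (\<open>one_minus_tensor_inversion_sum\<close>). Both sides turn out to be the same quotient of the
  multiplicative group.

  On the side of symbols, the five-term relations for \<open>(x, y)\<close> and \<open>(y, x)\<close> together give
  \<open>\<langle>u v\<rangle> = \<langle>u\<rangle> + \<langle>v\<rangle>\<close> and \<open>2 \<langle>u\<rangle> = 0\<close> (\<open>inversion_sum_mult\<close>, \<open>inversion_sum_double\<close>), and modulo
  \<open>c\<^sub>F\<close> the six-step cycle through \<open>x \<mapsto> x\<inverse>\<close> and \<open>x \<mapsto> 1 - x\<close> gives \<open>\<langle>-1\<rangle> = 0\<close>
  (\<open>inversion_sum_minus_one\<close>). So every element of the inversion subgroup is some \<open>\<langle>x\<rangle>\<close>, and
  \<open>\<langle>\<plusminus> y\<^sup>2\<rangle> = 0\<close>. On the side of tensors, \<open>x \<mapsto> x \<otimes> (-x)\<close> is additive (\<open>neg_right_mult\<close>), so every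
  element of the negation subgroup is some \<open>x \<otimes> (-x)\<close>. This makes \<open>f\<close> surjective. For injectivity,
  suppose that \<open>x\<close> is not of the form \<open>\<plusminus> y\<^sup>2\<close>. By Zorn's lemma a homomorphism \<open>\<phi>\<close> from the
  multiplicative group to \<open>\<int>/2\<close> has \<open>\<phi>(x) = 1\<close> and \<open>\<phi>(-1) = 0\<close> (\<open>index_two_subgroup_avoiding\<close>), and the
  form \<open>\<phi>(u) \<phi>(v)\<close> shows that \<open>x \<otimes> (-x)\<close> is not zero (\<open>neg_tensor_in_sigma_kernel\<close>).

  The second claim then is a diagram chase (\<open>iso_between_kernels\<close>). The natural map is surjective with
  kernel the inversion subgroup, since the two five-term relations differ by inversion sums; and the
  modified exterior square is the quotient of the skew tensor square by the negation subgroup, since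
  the skew relations are the polarisation of \<open>(-x) \<otimes> x\<close>. The boundary maps agree up to sign. As \<open>f\<close>
  is a bijection between the kernels of the two projections, the kernels of the two boundary maps are
  isomorphic.

  Computations take place in free abelian groups, additively and modulo a subgroup of relations; only
  at the end are they transferred to the iterated coset groups.
\<close>

section \<open>Quotients of abelian groups by generated subgroups\<close>

context comm_group
begin

lemma quotient_by_comm_group:
  "S \<subseteq> carrier G \<Longrightarrow> comm_group (quotient_by G S)"
  unfolding quotient_by_def by (intro abelian_FactGroup generate_is_subgroup)

lemma quotient_class_hom:
  assumes "S \<subseteq> carrier G"
  shows "quotient_class G S \<in> hom G (quotient_by G S)"
proof -
  have "generate G S \<lhd> G"
    using assms by (simp add: normal_iff_subgroup generate_is_subgroup)
  from normal.r_coset_hom_Mod[OF this] show ?thesis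
    by (simp add: quotient_by_def quotient_class_def[abs_def])
qed

lemma carrier_quotient_by: "carrier (quotient_by G S) = quotient_class G S ` carrier G"
  by (simp add: quotient_by_def quotient_class_def carrier_FactGroup)

lemma quotient_class_group_hom:
  assumes "S \<subseteq> carrier G"
  shows "group_hom G (quotient_by G S) (quotient_class G S)"
  using assms quotient_class_hom quotient_by_comm_group
  by (auto intro!: group_hom.intro group_hom_axioms.intro comm_group.axioms(2))

lemma quotient_class_eq_one_iff:
  assumes "S \<subseteq> carrier G" "x \<in> carrier G"
  shows "quotient_class G S x = \<one>\<^bsub>quotient_by G S\<^esub> \<longleftrightarrow> x \<in> generate G S"
  using assms
  by (auto simp: quotient_by_def quotient_class_def generate_is_subgroup coset_join1 coset_join2)

text \<open>
  The set \<open>h ` C\<close> is a singleton because \<open>h\<close> is trivial on the subgroup divided out; this is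
  what turns \<^const>\<open>induced_map\<close> into a computable map on representatives.
\<close>
lemma induced_map_quotient_class:
  assumes S: "S \<subseteq> carrier G" and h: "group_hom G H h"
    and kills: "\<And>s. s \<in> S \<Longrightarrow> h s = \<one>\<^bsub>H\<^esub>" and x: "x \<in> carrier G"
  shows "induced_map h (quotient_class G S x) = h x"
proof -
  interpret h: group_hom G H h by fact
  have sub: "generate G S \<subseteq> kernel G H h"
    using S kills by (intro generate_subgroup_incl h.subgroup_kernel) (auto simp: kernel_def)
  have "h ` (quotient_class G S x) = {h x}"
  proof -
    have "h y = h x" if "y \<in> quotient_class G S x" for y
    proof -
      from that obtain g where g: "g \<in> generate G S" "y = g \<otimes> x"
        by (auto simp: quotient_class_def r_coset_def)
      then have "g \<in> carrier G" "h g = \<one>\<^bsub>H\<^esub>"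
        using sub by (auto simp: kernel_def)
      with g x show ?thesis by simp
    qed
    moreover have "x \<in> quotient_class G S x"
      unfolding quotient_class_def
      using x S generate_is_subgroup rcos_self by blast
    ultimately show ?thesis by blast
  qed
  then show ?thesis by (simp add: induced_map_def)
qed

lemma induced_map_group_hom:
  assumes S: "S \<subseteq> carrier G" and h: "group_hom G H h"
    and kills: "\<And>s. s \<in> S \<Longrightarrow> h s = \<one>\<^bsub>H\<^esub>"
  shows "group_hom (quotient_by G S) H (induced_map h)"
proof -
  interpret h: group_hom G H h by fact
  interpret q: group_hom G "quotient_by G S" "quotient_class G S"
    by (rule quotient_class_group_hom[OF S])
  note im = induced_map_quotient_class[OF S h kills]
  have "induced_map h \<in> hom (quotient_by G S) H"
  proof (rule homI)
    fix C assume "C \<in> carrier (quotient_by G S)"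
    then show "induced_map h C \<in> carrier H"
      by (auto simp: carrier_quotient_by im)
  next
    fix C C' assume "C \<in> carrier (quotient_by G S)" "C' \<in> carrier (quotient_by G S)"
    then obtain x y where "x \<in> carrier G" "C = quotient_class G S x"
      "y \<in> carrier G" "C' = quotient_class G S y"
      by (auto simp: carrier_quotient_by)
    then show "induced_map h (C \<otimes>\<^bsub>quotient_by G S\<^esub> C') = induced_map h C \<otimes>\<^bsub>H\<^esub> induced_map h C'"
      by (simp add: im flip: q.hom_mult)
  qed
  then show ?thesis
    by (intro group_hom.intro group_hom_axioms.intro) auto
qed

text \<open>
  Both skew tensors and symbols modulo \<open>c\<^sub>F\<close> are quotients of quotients. An element that dies in
  the second quotient agrees in the first one with a word in \<open>T\<close>, so it is a word in \<open>S \<union> T\<close>.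
  Statements about such elements can therefore be proved by looking at the generators in the free
  abelian group only.
\<close>
lemma quotient_quotient_class_eq_one_iff:
  assumes S: "S \<subseteq> carrier G" and T: "T \<subseteq> carrier G" and x: "x \<in> carrier G"
  shows "quotient_class (quotient_by G S) (quotient_class G S ` T) (quotient_class G S x) =
           \<one>\<^bsub>quotient_by (quotient_by G S) (quotient_class G S ` T)\<^esub> \<longleftrightarrow> x \<in> generate G (S \<union> T)"
proof -
  interpret q: group_hom G "quotient_by G S" "quotient_class G S"
    by (rule quotient_class_group_hom[OF S])
  interpret Q: comm_group "quotient_by G S" by (rule quotient_by_comm_group[OF S])
  have ST: "S \<union> T \<subseteq> carrier G" using S T by blast
  have TQ: "quotient_class G S ` T \<subseteq> carrier (quotient_by G S)"
    using T by auto
  have "quotient_class G S x \<in> generate (quotient_by G S) (quotient_class G S ` T) \<longleftrightarrow>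
          x \<in> generate G (S \<union> T)"
  proof
    assume "quotient_class G S x \<in> generate (quotient_by G S) (quotient_class G S ` T)"
    then obtain t where t: "t \<in> generate G T" "quotient_class G S x = quotient_class G S t"
      using q.generate_img[OF T] by auto
    have tc: "t \<in> carrier G" using generate_in_carrier[OF T t(1)] .
    have "quotient_class G S (x \<otimes> inv t) = \<one>\<^bsub>quotient_by G S\<^esub>"
      using t x tc by simp
    then have "x \<otimes> inv t \<in> generate G S"
      using quotient_class_eq_one_iff[OF S, of "x \<otimes> inv t"] x tc by blast
    then have "x \<otimes> inv t \<in> generate G (S \<union> T)" "t \<in> generate G (S \<union> T)"
      using mono_generate[of S "S \<union> T"] mono_generate[of T "S \<union> T"] t(1) by auto
    then have "x \<otimes> inv t \<otimes> t \<in> generate G (S \<union> T)"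
      by (rule generate.eng)
    then show "x \<in> generate G (S \<union> T)" using x tc by (simp add: m_assoc)
  next
    assume "x \<in> generate G (S \<union> T)"
    then have "quotient_class G S x \<in> generate (quotient_by G S) (quotient_class G S ` (S \<union> T))"
      using q.generate_img[OF ST] by blast
    also have "\<dots> \<subseteq> generate (quotient_by G S) (quotient_class G S ` T)"
    proof (rule q.H.generate_subgroup_incl)
      show "subgroup (generate (quotient_by G S) (quotient_class G S ` T)) (quotient_by G S)"
        by (rule q.H.generate_is_subgroup[OF TQ])
      have "quotient_class G S s = \<one>\<^bsub>quotient_by G S\<^esub>" if "s \<in> S" for s
        using that S quotient_class_eq_one_iff[OF S, of s] generate.incl[of s S] by auto
      then show "quotient_class G S ` (S \<union> T) \<subseteq> generate (quotient_by G S) (quotient_class G S ` T)"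
        by (auto intro: generate.intros)
    qed
    finally show "quotient_class G S x \<in> generate (quotient_by G S) (quotient_class G S ` T)" .
  qed
  then show ?thesis
    using Q.quotient_class_eq_one_iff[OF TQ, of "quotient_class G S x"] x by auto
qed

end

section \<open>Homomorphisms from free abelian groups\<close>

context comm_group
begin

lemma free_ext_frag_of:
  assumes "f x \<in> carrier G"
  shows "free_ext G f (frag_of x) = f x"
  using assms by (simp add: free_ext_def)

lemma free_ext_group_hom:
  assumes f: "f ` B \<subseteq> carrier G"
  shows "group_hom (free_Abelian_group B) G (free_ext G f)"
proof -
  have fB: "f x \<in> carrier G" if "x \<in> B" for x using f that by auto
  have ext: "finprod G (\<lambda>x. f x [^] Poly_Mapping.lookup c x) K = free_ext G f c"
    if "Poly_Mapping.keys c \<subseteq> K" "K \<subseteq> B" "finite K" for c K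
    unfolding free_ext_def using that fB
    by (intro finprod_mono_neutral_cong_right) (auto simp: in_keys_iff)
  have "free_ext G f \<in> hom (free_Abelian_group B) G"
  proof (rule homI)
    fix c assume "c \<in> carrier (free_Abelian_group B)"
    then show "free_ext G f c \<in> carrier G"
      unfolding free_ext_def using fB by (intro finprod_closed) auto
  next
    fix c d assume cd: "c \<in> carrier (free_Abelian_group B)" "d \<in> carrier (free_Abelian_group B)"
    let ?K = "Poly_Mapping.keys c \<union> Poly_Mapping.keys d"
    have K: "?K \<subseteq> B" "finite ?K" using cd by auto
    have "free_ext G f (c + d) = finprod G (\<lambda>x. f x [^] Poly_Mapping.lookup (c + d) x) ?K"
      using K Poly_Mapping.keys_add[of c d] by (intro ext[symmetric]) auto
    also have "\<dots> = finprod G (\<lambda>x. f x [^] Poly_Mapping.lookup c x \<otimes> f x [^] Poly_Mapping.lookup d x) ?K"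
      using K fB by (intro finprod_cong) (auto simp: lookup_add int_pow_mult subset_iff simp_implies_def)
    also have "\<dots> = finprod G (\<lambda>x. f x [^] Poly_Mapping.lookup c x) ?K \<otimes>
                      finprod G (\<lambda>x. f x [^] Poly_Mapping.lookup d x) ?K"
      using K fB by (intro finprod_multf) auto
    also have "\<dots> = free_ext G f c \<otimes> free_ext G f d"
      using K by (simp add: ext)
    finally show "free_ext G f (c \<otimes>\<^bsub>free_Abelian_group B\<^esub> d) = free_ext G f c \<otimes> free_ext G f d"
      by simp
  qed
  then show ?thesis
    by (intro group_hom.intro group_hom_axioms.intro) (auto simp: is_group)
qed

end

lemma free_Abelian_group_hom_add:
  assumes "group_hom (free_Abelian_group B) G h"
    and "Poly_Mapping.keys z \<subseteq> B" "Poly_Mapping.keys w \<subseteq> B"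
  shows "h (z + w) = h z \<otimes>\<^bsub>G\<^esub> h w"
  using group_hom.hom_mult[OF assms(1), of z w] assms by simp

lemma free_Abelian_group_hom_uminus:
  assumes "group_hom (free_Abelian_group B) G h" and "Poly_Mapping.keys z \<subseteq> B"
  shows "h (- z) = inv\<^bsub>G\<^esub> h z"
  using group_hom.hom_inv[OF assms(1), of z] assms by simp

lemma free_Abelian_group_hom_diff:
  assumes "group_hom (free_Abelian_group B) G h"
    and "Poly_Mapping.keys z \<subseteq> B" "Poly_Mapping.keys w \<subseteq> B"
  shows "h (z - w) = h z \<otimes>\<^bsub>G\<^esub> inv\<^bsub>G\<^esub> h w"
  using free_Abelian_group_hom_add[OF assms(1), of z "- w"] free_Abelian_group_hom_uminus[OF assms(1), of w] assms
  by simp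

text \<open>
  The map defined on the free abelian group by values on basis elements is only ever used through
  this principle: it agrees with a composite of quotient maps because both have the same values on
  the basis.
\<close>
lemma free_Abelian_group_hom_cong:
  assumes "group_hom (free_Abelian_group B) G g" "group_hom (free_Abelian_group B) G h"
    and "\<And>x. x \<in> B \<Longrightarrow> g (frag_of x) = h (frag_of x)"
    and "Poly_Mapping.keys z \<subseteq> B"
  shows "g z = h z"
proof (rule free_Abelian_group_induct[OF assms(4)])
  show "g 0 = h 0" using group_hom.hom_one[OF assms(1)] group_hom.hom_one[OF assms(2)] by simp
next
  fix x y
  assume "Poly_Mapping.keys x \<subseteq> B" "Poly_Mapping.keys y \<subseteq> B" "g x = h x" "g y = h y"
  then show "g (x - y) = h (x - y)"
    by (simp add: free_Abelian_group_hom_diff[OF assms(1)] free_Abelian_group_hom_diff[OF assms(2)])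
qed (use assms in auto)

text \<open>
  Transfers an additive congruence between representatives to the multiplicative quotient group;
  all computations with relations are done additively in the free abelian group.
\<close>
lemma free_Abelian_group_hom_mult_cong:
  assumes h: "group_hom (free_Abelian_group B) G h"
    and c: "a \<in> carrier (free_Abelian_group B)" "b \<in> carrier (free_Abelian_group B)"
      "c \<in> carrier (free_Abelian_group B)"
    and k: "h (c - a - b) = \<one>\<^bsub>G\<^esub>"
  shows "h c = h a \<otimes>\<^bsub>G\<^esub> h b"
proof -
  interpret h: group_hom "free_Abelian_group B" G h by fact
  have ab: "Poly_Mapping.keys (a + b) \<subseteq> B" using c Poly_Mapping.keys_add[of a b] by auto
  have "h (c - (a + b)) = h c \<otimes>\<^bsub>G\<^esub> inv\<^bsub>G\<^esub> (h (a + b))"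
    using c ab by (intro free_Abelian_group_hom_diff[OF h]) auto
  then have "h c = h (a + b)"
    using k c(3) ab h.hom_closed[of c] h.hom_closed[of "a + b"]
    by (simp add: diff_diff_eq h.H.inv_solve_right')
  then show ?thesis
    using c by (simp add: free_Abelian_group_hom_add[OF h])
qed

lemma group_hom_compose:
  assumes "group_hom G H g" "group_hom H K h"
  shows "group_hom G K (\<lambda>x. h (g x))"
  using assms by (auto simp: group_hom_def group_hom_axioms_def hom_def)

lemma group_hom_comp_uminus:
  assumes "group_hom (free_Abelian_group B) G h"
  shows "group_hom (free_Abelian_group B) G (\<lambda>z. h (- z))"
proof -
  have "h (- (z + w)) = h (- z) \<otimes>\<^bsub>G\<^esub> h (- w)"
    if "Poly_Mapping.keys z \<subseteq> B" "Poly_Mapping.keys w \<subseteq> B" for z w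
    using free_Abelian_group_hom_add[OF assms, of "- z" "- w"] that by simp
  then show ?thesis
    using assms by (auto simp: group_hom_def group_hom_axioms_def hom_def)
qed

lemma frag_extend_group_hom:
  assumes "\<And>x. x \<in> B \<Longrightarrow> Poly_Mapping.keys (f x) \<subseteq> C"
  shows "group_hom (free_Abelian_group B) (free_Abelian_group C) (frag_extend f)"
proof -
  have "Poly_Mapping.keys (frag_extend f z) \<subseteq> C" if "Poly_Mapping.keys z \<subseteq> B" for z
    using keys_frag_extend[of f z] assms that by blast
  then show ?thesis
    by (intro group_hom.intro group_hom_axioms.intro)
       (auto simp: hom_def frag_extend_add)
qed

text \<open>
  The generators are indexed by \<open>x \<noteq> 0, 1\<close>, but a family that is multiplicative in \<open>x\<close> is the
  image of the group of all \<open>x \<noteq> 0\<close>: its elements are already closed under products and inverses,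
  and \<open>x = 1\<close> gives the neutral element.
\<close>
lemma generate_image_Fflat:
  fixes g :: "'a::field \<Rightarrow> 'g"
  assumes "group G" and carr: "\<And>x. x \<noteq> 0 \<Longrightarrow> g x \<in> carrier G"
    and mult: "\<And>x y. x \<noteq> 0 \<Longrightarrow> y \<noteq> 0 \<Longrightarrow> g (x * y) = g x \<otimes>\<^bsub>G\<^esub> g y"
  shows "generate G (g ` Fflat F) = g ` (- {0})"
proof -
  interpret group G by fact
  have one: "g 1 = \<one>\<^bsub>G\<^esub>"
    using mult[of 1 1] carr[of 1] by simp
  have inv: "g (inverse x) = inv\<^bsub>G\<^esub> (g x)" if "x \<noteq> 0" for x
    using that mult[of "inverse x" x] carr one by (intro inv_equality[symmetric]) auto
  have "subgroup (g ` (- {0})) G"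
  proof (rule subgroupI)
    show "g ` (- {0}) \<subseteq> carrier G" using carr by auto
    show "g ` (- {0}) \<noteq> {}" proof -
      have "g 1 \<in> g ` (- {0})" by (rule imageI) simp
      then show ?thesis by blast
    qed
    show "inv\<^bsub>G\<^esub> a \<in> g ` (- {0})" if "a \<in> g ` (- {0})" for a
      using that by (auto simp: inv[symmetric])
    show "a \<otimes>\<^bsub>G\<^esub> b \<in> g ` (- {0})" if "a \<in> g ` (- {0})" "b \<in> g ` (- {0})" for a b
      using that by (auto simp: mult[symmetric])
  qed
  then have "generate G (g ` Fflat F) \<subseteq> g ` (- {0})"
    by (intro generate_subgroup_incl) (auto simp: Fflat_def)
  moreover have "g x \<in> generate G (g ` Fflat F)" if "x \<noteq> 0" for x
    using that one by (cases "x = 1") (auto simp: Fflat_def intro: generate.intros)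
  ultimately show ?thesis by auto
qed

section \<open>Kernels of compatible homomorphisms\<close>

text \<open>
  The part of the snake lemma that is needed. In a square with horizontal maps \<open>d : A \<rightarrow> B\<close> and
  \<open>d' : A' \<rightarrow> B'\<close>, a bijection between the kernels of the vertical maps \<open>p\<close> and \<open>r\<close> makes \<open>p\<close> an
  isomorphism between the kernels of the horizontal ones. Instead of commutativity, the two ways
  around the square are only required to vanish on the same elements, which allows for the sign by
  which the two boundary maps differ.
\<close>
lemma iso_between_kernels:
  assumes d: "group_hom A B d" and p: "group_hom A A' p" and r: "group_hom B B' r"
    and d': "group_hom A' B' d'"
    and surj: "p ` carrier A = carrier A'"
    and bij: "bij_betw d (kernel A A' p) (kernel B B' r)"
    and comm: "\<And>a. a \<in> carrier A \<Longrightarrow> d' (p a) = \<one>\<^bsub>B'\<^esub> \<longleftrightarrow> r (d a) = \<one>\<^bsub>B'\<^esub>"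
  shows "p \<in> iso (A\<lparr>carrier := kernel A B d\<rparr>) (A'\<lparr>carrier := kernel A' B' d'\<rparr>)"
proof -
  interpret d: group_hom A B d by fact
  interpret p: group_hom A A' p by fact
  interpret r: group_hom B B' r by fact
  interpret d': group_hom A' B' d' by fact
  let ?K = "A\<lparr>carrier := kernel A B d\<rparr>" and ?K' = "A'\<lparr>carrier := kernel A' B' d'\<rparr>"
  have gK: "group ?K" "group ?K'"
    by (auto intro!: subgroup.subgroup_is_group d.subgroup_kernel d'.subgroup_kernel)
  have hom: "p \<in> hom ?K ?K'"
    by (auto simp: hom_def kernel_def comm)
  have one: "\<one>\<^bsub>A\<^esub> \<in> kernel A A' p" by (simp add: kernel_def)
  have "a = \<one>\<^bsub>A\<^esub>" if "a \<in> carrier A" "d a = \<one>\<^bsub>B\<^esub>" "p a = \<one>\<^bsub>A'\<^esub>" for a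
    using inj_onD[OF bij_betw_imp_inj_on[OF bij] _ _ one, of a] that by (simp add: kernel_def)
  then have ker: "kernel ?K ?K' p = {\<one>\<^bsub>?K\<^esub>}"
    by (auto simp: kernel_def)
  have "p ` kernel A B d = kernel A' B' d'"
  proof
    show "p ` kernel A B d \<subseteq> kernel A' B' d'"
      by (auto simp: kernel_def comm)
    show "kernel A' B' d' \<subseteq> p ` kernel A B d"
    proof
      fix b assume b: "b \<in> kernel A' B' d'"
      then obtain a where a: "a \<in> carrier A" "b = p a"
        using surj by (auto simp: kernel_def)
      \<comment> \<open>The image of a lift \<open>a\<close> of \<open>b\<close> lies in the kernel of \<open>r\<close>, so it equals \<open>d i\<close> for some \<open>i\<close>
         in the kernel of \<open>p\<close>; dividing by \<open>i\<close> corrects the lift.\<close>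
      have "d a \<in> kernel B B' r"
        using a b comm by (simp add: kernel_def)
      then obtain i where i: "i \<in> kernel A A' p" "d i = d a"
        using bij by (metis bij_betw_iff_bijections)
      then have ic: "i \<in> carrier A" "p i = \<one>\<^bsub>A'\<^esub>" by (auto simp: kernel_def)
      have "a \<otimes>\<^bsub>A\<^esub> inv\<^bsub>A\<^esub> i \<in> kernel A B d" "p (a \<otimes>\<^bsub>A\<^esub> inv\<^bsub>A\<^esub> i) = b"
        using a i ic by (simp_all add: kernel_def)
      then show "b \<in> p ` kernel A B d" by blast
    qed
  qed
  then show ?thesis
    using iso_kernel_image[OF gK, of p] hom ker by simp
qed

section \<open>Consequences of bilinearity and skew-symmetry\<close>

text \<open>
  A relation \<open>z \<equiv> w\<close> modulo \<open>L\<close> is written \<open>z - w \<in> L\<close>. In this form, a combination of relations is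
  an identity in the ambient additive group, which simplification can verify.
\<close>
locale closed_under_difference =
  fixes L :: "'g::ab_group_add set"
  assumes zero_mem: "0 \<in> L"
    and diff_mem: "z \<in> L \<Longrightarrow> w \<in> L \<Longrightarrow> z - w \<in> L"
begin

lemma uminus_mem: "z \<in> L \<Longrightarrow> - z \<in> L"
  using diff_mem[OF zero_mem, of z] by simp

lemma add_mem: "z \<in> L \<Longrightarrow> w \<in> L \<Longrightarrow> z + w \<in> L"
  using diff_mem[OF _ uminus_mem, of z w] by simp

lemmas mem = zero_mem diff_mem uminus_mem add_mem

end

locale bilinear_relations = closed_under_difference L
  for L :: "('a::field \<times> 'a \<Rightarrow>\<^sub>0 int) set" +
  assumes mult_left: "\<lbrakk>x \<noteq> 0; x' \<noteq> 0; y \<noteq> 0\<rbrakk> \<Longrightarrow>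
      frag_of (x * x', y) - frag_of (x, y) - frag_of (x', y) \<in> L"
    and mult_right: "\<lbrakk>x \<noteq> 0; y \<noteq> 0; y' \<noteq> 0\<rbrakk> \<Longrightarrow>
      frag_of (x, y * y') - frag_of (x, y) - frag_of (x, y') \<in> L"
begin

lemma one_left: "y \<noteq> 0 \<Longrightarrow> frag_of (1, y) \<in> L"
  using uminus_mem[OF mult_left[of 1 1 y]] by simp

lemma divide_left: "\<lbrakk>x \<noteq> 0; x' \<noteq> 0; y \<noteq> 0\<rbrakk> \<Longrightarrow>
    frag_of (x / x', y) - (frag_of (x, y) - frag_of (x', y)) \<in> L"
  using uminus_mem[OF mult_left[of "x / x'" x' y]] by (simp add: algebra_simps)

lemma divide_right: "\<lbrakk>x \<noteq> 0; y \<noteq> 0; y' \<noteq> 0\<rbrakk> \<Longrightarrow>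
    frag_of (x, y / y') - (frag_of (x, y) - frag_of (x, y')) \<in> L"
  using uminus_mem[OF mult_right[of x "y / y'" y']] by (simp add: algebra_simps)

lemma divide_divide:
  assumes "x \<noteq> 0" "x' \<noteq> 0" "y \<noteq> 0" "y' \<noteq> 0"
  shows "frag_of (x / x', y / y') -
    (frag_of (x, y) - frag_of (x, y') - frag_of (x', y) + frag_of (x', y')) \<in> L"
  using add_mem[OF divide_left[of x x' "y / y'"]
      diff_mem[OF divide_right[of x y y'] divide_right[of x' y y']]] assms
  by (simp add: algebra_simps)

lemma mult_mult:
  assumes "x \<noteq> 0" "x' \<noteq> 0" "y \<noteq> 0" "y' \<noteq> 0"
  shows "frag_of (x * x', y * y') -
    (frag_of (x, y) + frag_of (x, y') + frag_of (x', y) + frag_of (x', y')) \<in> L"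
  using add_mem[OF mult_left[of x x' "y * y'"]
      add_mem[OF mult_right[of x y y'] mult_right[of x' y y']]] assms
  by (simp add: algebra_simps)

text \<open>
  Polarisation of \<open>(-x) \<otimes> x\<close>: expanding \<open>(-xy) \<otimes> xy\<close> leaves \<open>y \<otimes> x + x \<otimes> y\<close> once \<open>(-x) \<otimes> x\<close> and
  \<open>(-y) \<otimes> y\<close> are removed. Hence the modified exterior square is a quotient of the skew tensor square.
\<close>
lemma skew_of_wedge:
  assumes wedge: "\<And>x. x \<noteq> 0 \<Longrightarrow> frag_of (- x, x) \<in> L"
    and "x \<noteq> 0" "y \<noteq> 0"
  shows "frag_of (x, y) + frag_of (y, x) \<in> L"
proof -
  have a: "frag_of (- x * y, x * y) \<in> L"
    using wedge[of "x * y"] assms by simp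
  have b: "frag_of (- x * y, x * y) -
      (frag_of (- x, x) + frag_of (- x, y) + frag_of (y, x) + frag_of (y, y)) \<in> L"
    using mult_mult[of "- x" y x y] assms by simp
  have c: "frag_of (- 1 * x, y) - frag_of (- 1, y) - frag_of (x, y) \<in> L"
    using mult_left[of "- 1" x y] assms by simp
  have d: "frag_of (- 1 * y, y) - frag_of (- 1, y) - frag_of (y, y) \<in> L"
    using mult_left[of "- 1" y y] assms by simp
  have "frag_of (x, y) + frag_of (y, x) =
      frag_of (- x * y, x * y) - (frag_of (- x * y, x * y) -
      (frag_of (- x, x) + frag_of (- x, y) + frag_of (y, x) + frag_of (y, y)))
      - (frag_of (- 1 * x, y) - frag_of (- 1, y) - frag_of (x, y))
      + (frag_of (- 1 * y, y) - frag_of (- 1, y) - frag_of (y, y))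
      - frag_of (- x, x) - frag_of (- y, y)"
    by (simp add: algebra_simps)
  also have "\<dots> \<in> L"
    by (intro mem a b c d wedge assms)
  finally show ?thesis .
qed

end

text \<open>
  The map \<open>[x] \<mapsto> x \<otimes> (1 - x)\<close> before any relations are imposed; both boundary maps are induced by
  it, the second one with a minus sign.
\<close>
definition one_minus_tensor :: "('a::field \<Rightarrow>\<^sub>0 int) \<Rightarrow> ('a \<times> 'a \<Rightarrow>\<^sub>0 int)" where
  "one_minus_tensor = frag_extend (\<lambda>x. frag_of (x, 1 - x))"

lemma one_minus_tensor_simps [simp]:
  "one_minus_tensor 0 = 0"
  "one_minus_tensor (frag_of x) = frag_of (x, 1 - x)"
  "one_minus_tensor (z + w) = one_minus_tensor z + one_minus_tensor w"
  "one_minus_tensor (z - w) = one_minus_tensor z - one_minus_tensor w"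
  "one_minus_tensor (- z) = - one_minus_tensor z"
  by (simp_all add: one_minus_tensor_def frag_extend_add frag_extend_diff frag_extend_minus)

definition five_term :: "'a::field \<Rightarrow> 'a \<Rightarrow> ('a \<Rightarrow>\<^sub>0 int)" where
  "five_term x y = frag_of x - frag_of y + frag_of (y / x) + frag_of ((1 - x) / (1 - y))
     - frag_of ((1 - inverse x) / (1 - inverse y))"

text \<open>
  With the value \<open>0\<close> at \<open>x = 1\<close>, where the symbol \<open>[x]\<close> does not exist, \<open>[x] + [x\<inverse>]\<close> becomes
  multiplicative on all nonzero \<open>x\<close>.
\<close>
definition inversion_sum :: "'a::field \<Rightarrow> ('a \<Rightarrow>\<^sub>0 int)" where
  "inversion_sum x = (if x = 1 then 0 else frag_of x + frag_of (inverse x))"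

lemma inversion_sum_simps [simp]:
  "inversion_sum 1 = 0"
  "inversion_sum (inverse x) = inversion_sum x"
  by (auto simp: inversion_sum_def)

locale skew_relations = bilinear_relations L for L :: "('a::field \<times> 'a \<Rightarrow>\<^sub>0 int) set" +
  assumes skew: "\<lbrakk>x \<noteq> 0; y \<noteq> 0\<rbrakk> \<Longrightarrow> frag_of (x, y) + frag_of (y, x) \<in> L"
begin

text \<open>
  The map \<open>x \<mapsto> x \<otimes> (-x)\<close> is a quadratic form whose polar form \<open>x \<otimes> y + y \<otimes> x\<close> vanishes, so it is
  additive.
\<close>
lemma neg_right_mult:
  assumes "x \<noteq> 0" "y \<noteq> 0"
  shows "frag_of (x * y, - (x * y)) - frag_of (x, - x) - frag_of (y, - y) \<in> L"
proof -
  have a: "frag_of (x * y, - x * y) -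
      (frag_of (x, - x) + frag_of (x, y) + frag_of (y, - x) + frag_of (y, y)) \<in> L"
    using mult_mult[of x y "- x" y] assms by simp
  have b: "frag_of (y, - 1 * x) - frag_of (y, - 1) - frag_of (y, x) \<in> L"
    using mult_right[of y "- 1" x] assms by simp
  have c: "frag_of (y, - 1 * y) - frag_of (y, - 1) - frag_of (y, y) \<in> L"
    using mult_right[of y "- 1" y] assms by simp
  have d: "frag_of (x, y) + frag_of (y, x) \<in> L"
    using skew assms .
  from add_mem[OF diff_mem[OF add_mem[OF a b] c] d]
  show ?thesis by (simp add: algebra_simps)
qed

text \<open>
  Since \<open>1 - x\<inverse> = (1 - x) / (-x)\<close>, the image of \<open>[x\<inverse>]\<close> is \<open>x \<otimes> (-x) - x \<otimes> (1 - x)\<close>.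
\<close>
lemma one_minus_tensor_inversion_sum:
  assumes "x \<noteq> 0"
  shows "one_minus_tensor (inversion_sum x) - frag_of (x, - x) \<in> L"
proof (cases "x = 1")
  case True
  then show ?thesis using one_left[of "- 1"] uminus_mem by simp
next
  case False
  have eq: "1 - inverse x = (1 - x) / (- x)"
    using assms by (simp add: field_simps)
  have "frag_of (inverse x, 1 - inverse x) -
      (frag_of (1, 1 - x) - frag_of (1, - x) - frag_of (x, 1 - x) + frag_of (x, - x)) \<in> L"
    using divide_divide[of 1 x "1 - x" "- x"] assms False
    unfolding eq by (simp add: inverse_eq_divide)
  from add_mem[OF this diff_mem[OF one_left[of "1 - x"] one_left[of "- x"]]]
  show ?thesis
    using assms False by (simp add: inversion_sum_def algebra_simps)
qed

text \<open>
  All arguments of the five-term relation, and one minus each of them, are quotients of products of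
  \<open>x\<close>, \<open>y\<close>, \<open>A = 1 - x\<close>, \<open>B = 1 - y\<close>, \<open>C = x - y\<close>. After bilinear expansion, everything cancels
  except \<open>(x \<otimes> A + A \<otimes> x) - (x \<otimes> B + B \<otimes> x)\<close>.
\<close>
lemma one_minus_tensor_five_term:
  assumes "x \<noteq> 0" "x \<noteq> 1" "y \<noteq> 0" "y \<noteq> 1" "x \<noteq> y"
  shows "one_minus_tensor (five_term x y) \<in> L"
proof -
  define A B C where "A = 1 - x" and "B = 1 - y" and "C = x - y"
  have nz: "x \<noteq> 0" "y \<noteq> 0" "A \<noteq> 0" "B \<noteq> 0" "C \<noteq> 0"
    using assms by (auto simp: A_def B_def C_def)
  have e1: "1 - y / x = C / x" "1 - A / B = C / B"
    using nz by (simp_all add: A_def B_def C_def field_simps)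
  have e2: "(1 - inverse x) / (1 - inverse y) = (y * A) / (x * B)"
    using nz by (simp add: A_def B_def divide_simps) (simp add: algebra_simps)
  have e3: "1 - (y * A) / (x * B) = C / (x * B)"
    using nz by (simp add: divide_simps) (simp add: A_def B_def C_def algebra_simps)
  have D: "one_minus_tensor (five_term x y) =
      frag_of (x, A) - frag_of (y, B) + frag_of (y / x, C / x) + frag_of (A / B, C / B)
      - frag_of ((y * A) / (x * B), C / (x * B))"
    unfolding five_term_def by (simp add: e1 e2 e3 flip: A_def B_def)
  define m1 where "m1 = frag_of (y / x, C / x) -
    (frag_of (y, C) - frag_of (y, x) - frag_of (x, C) + frag_of (x, x))"
  define m2 where "m2 = frag_of (A / B, C / B) -
    (frag_of (A, C) - frag_of (A, B) - frag_of (B, C) + frag_of (B, B))"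
  define m3 where "m3 = frag_of ((y * A) / (x * B), C / (x * B)) -
    (frag_of (y * A, C) - frag_of (y * A, x * B) - frag_of (x * B, C) + frag_of (x * B, x * B))"
  define m4 where "m4 = frag_of (y * A, C) - frag_of (y, C) - frag_of (A, C)"
  define m5 where "m5 = frag_of (y * A, x * B) -
    (frag_of (y, x) + frag_of (y, B) + frag_of (A, x) + frag_of (A, B))"
  define m6 where "m6 = frag_of (x * B, C) - frag_of (x, C) - frag_of (B, C)"
  define m7 where "m7 = frag_of (x * B, x * B) -
    (frag_of (x, x) + frag_of (x, B) + frag_of (B, x) + frag_of (B, B))"
  have m: "m1 \<in> L" "m2 \<in> L" "m3 \<in> L" "m4 \<in> L" "m5 \<in> L" "m6 \<in> L" "m7 \<in> L"
    unfolding m1_def m2_def m3_def m4_def m5_def m6_def m7_def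
    using nz by (auto intro!: divide_divide mult_left mult_mult)
  have "one_minus_tensor (five_term x y) = m1 + m2 - m3 - m4 + m5 + m6 - m7
      + (frag_of (x, A) + frag_of (A, x)) - (frag_of (x, B) + frag_of (B, x))"
    unfolding D m1_def m2_def m3_def m4_def m5_def m6_def m7_def by (simp add: algebra_simps)
  also have "\<dots> \<in> L"
    using nz by (intro mem m skew) simp_all
  finally show ?thesis .
qed

end

section \<open>Consequences of the five-term relation\<close>

text \<open>
  This is how the bound on the size of the field enters: doubling an inversion sum needs an
  auxiliary element different from \<open>0\<close>, \<open>1\<close> and \<open>u\<inverse>\<close>.
\<close>
lemma exists_notin_of_card_ge_4:
  assumes "infinite (UNIV :: 'a set) \<or> card (UNIV :: 'a set) \<ge> 4"
  obtains v :: 'a where "v \<notin> {a, b, c}"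
proof -
  have "card {a, b, c} < 4" "finite {a, b, c}"
    by (simp_all add: card_insert_if)
  then have "{a, b, c} \<noteq> UNIV"
    using assms by (metis not_less)
  then show ?thesis using that by blast
qed

locale suslin_relations = closed_under_difference K
  for K :: "('a::field \<Rightarrow>\<^sub>0 int) set" +
  assumes five_term: "\<lbrakk>x \<noteq> 0; x \<noteq> 1; y \<noteq> 0; y \<noteq> 1; x \<noteq> y\<rbrakk> \<Longrightarrow> five_term x y \<in> K"
begin

text \<open>
  The substitution \<open>(x, y) \<mapsto> (1 - y, 1 - x)\<close> permutes the last three terms of the five-term
  relation, so the difference of the two relations only involves the first two terms.
\<close>
lemma complement_sum_const:
  assumes "x \<noteq> 0" "x \<noteq> 1" "y \<noteq> 0" "y \<noteq> 1"
  shows "(frag_of x + frag_of (1 - x)) - (frag_of y + frag_of (1 - y)) \<in> K"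
proof (cases "x = y")
  case True
  then show ?thesis using zero_mem by simp
next
  case False
  have e: "(1 - inverse (1 - y)) / (1 - inverse (1 - x)) = (1 - inverse x) / (1 - inverse y)"
    using assms by (simp add: divide_simps) (simp add: algebra_simps)
  have "five_term x y - five_term (1 - y) (1 - x) =
     (frag_of x + frag_of (1 - x)) - (frag_of y + frag_of (1 - y))"
    unfolding five_term_def e by simp
  moreover have "five_term x y - five_term (1 - y) (1 - x) \<in> K"
    using assms False by (intro mem five_term) auto
  ultimately show ?thesis by simp
qed

text \<open>
  Adding the five-term relations for \<open>(x, y)\<close> and \<open>(y, x)\<close> cancels \<open>[x] - [y]\<close> and leaves the
  inversion sums of \<open>u = y / x\<close>, \<open>v = (1 - x) / (1 - y)\<close> and \<open>u v\<close>. Solving the two equations for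
  \<open>x\<close> and \<open>y\<close> shows that generic \<open>u\<close>, \<open>v\<close> occur.
\<close>
lemma inversion_sum_mult_generic:
  assumes "u \<noteq> 0" "v \<noteq> 0" "u \<noteq> 1" "v \<noteq> 1" "u * v \<noteq> 1"
  shows "inversion_sum (u * v) - inversion_sum u - inversion_sum v \<in> K"
proof -
  define x where "x = (1 - v) / (1 - u * v)"
  define y where "y = u * x"
  have x: "x \<noteq> 0" "x \<noteq> 1" and y: "y \<noteq> 0" "y \<noteq> 1"
    using assms by (auto simp: x_def y_def divide_simps algebra_simps)
  have xy: "x \<noteq> y"
    using x assms by (auto simp: y_def)
  have u: "y / x = u" "x / y = inverse u"
    using x assms by (auto simp: y_def field_simps)
  have "1 - x = v * (1 - y)"
    using assms by (simp add: x_def y_def divide_simps) (simp add: algebra_simps)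
  then have v: "(1 - x) / (1 - y) = v" "(1 - y) / (1 - x) = inverse v"
    using y assms by (auto simp: field_simps)
  have "(1 - inverse x) / (1 - inverse y) = (y / x) * ((1 - x) / (1 - y))"
    using x y by (simp add: divide_simps) (simp add: algebra_simps)
  then have uv: "(1 - inverse x) / (1 - inverse y) = u * v"
    unfolding u v .
  then have uv': "(1 - inverse y) / (1 - inverse x) = inverse (u * v)"
    by (metis inverse_divide)
  have "- (five_term x y + five_term y x) \<in> K"
    using x y xy by (intro mem five_term) auto
  then show ?thesis
    using assms by (simp add: five_term_def u v uv uv' inversion_sum_def algebra_simps)
qed

text \<open>
  Use multiplicativity for \<open>(u, v)\<close> and for \<open>(u\<inverse>, u v)\<close>, and that \<open>u\<close> and \<open>u\<inverse>\<close> have the same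
  inversion sum.
\<close>
lemma inversion_sum_double:
  assumes card: "infinite (UNIV :: 'a set) \<or> card (UNIV :: 'a set) \<ge> 4" and "u \<noteq> 0"
  shows "inversion_sum u + inversion_sum u \<in> K"
proof (cases "u = 1")
  case True
  then show ?thesis using zero_mem by simp
next
  case False
  obtain v where v: "v \<notin> {0, 1, inverse u}"
    by (rule exists_notin_of_card_ge_4[OF card])
  then have uv: "u * v \<noteq> 1"
    using inverse_unique[of u v] by auto
  have a: "inversion_sum (u * v) - inversion_sum u - inversion_sum v \<in> K"
    using v uv False assms by (intro inversion_sum_mult_generic) auto
  have e: "inverse u * (u * v) = v" using assms by (simp flip: mult.assoc)
  have "inversion_sum (inverse u * (u * v)) - inversion_sum (inverse u)
      - inversion_sum (u * v) \<in> K"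
    using v uv False assms by (intro inversion_sum_mult_generic) (auto simp: e)
  then have b: "inversion_sum v - inversion_sum u - inversion_sum (u * v) \<in> K"
    by (simp add: e)
  from uminus_mem[OF add_mem[OF a b]]
  show ?thesis by (simp add: algebra_simps)
qed

lemma inversion_sum_mult:
  assumes card: "infinite (UNIV :: 'a set) \<or> card (UNIV :: 'a set) \<ge> 4"
    and "u \<noteq> 0" "v \<noteq> 0"
  shows "inversion_sum (u * v) - inversion_sum u - inversion_sum v \<in> K"
proof -
  consider "u = 1 \<or> v = 1" | "u \<noteq> 1" "v \<noteq> 1" "u * v \<noteq> 1" | "u * v = 1" by blast
  then show ?thesis
  proof cases
    case 1
    then show ?thesis using zero_mem by auto
  next
    case 2
    then show ?thesis using assms by (intro inversion_sum_mult_generic)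
  next
    case 3
    then have "v = inverse u" by (metis inverse_unique)
    then show ?thesis
      using 3 uminus_mem[OF inversion_sum_double[OF card, of u]] assms by simp
  qed
qed

end

locale reduced_suslin_relations = suslin_relations K for K :: "('a::field \<Rightarrow>\<^sub>0 int) set" +
  assumes complement_sum: "\<lbrakk>x \<noteq> 0; x \<noteq> 1\<rbrakk> \<Longrightarrow> frag_of x + frag_of (1 - x) \<in> K"
    and card: "infinite (UNIV :: 'a set) \<or> card (UNIV :: 'a set) \<ge> 4"
begin

text \<open>
  The maps \<open>x \<mapsto> x\<inverse>\<close> and \<open>x \<mapsto> 1 - x\<close> generate a finite group in which alternating them returns
  to \<open>x\<close> after six steps. Modulo the relations \<open>[x] + [1 - x] = 0\<close> the cycle says that the inversion
  sums of \<open>x\<close>, \<open>1 - x\<inverse>\<close> and \<open>1 - x\<close> add up to zero; the product of these three elements is minus a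
  square.
\<close>
lemma inversion_sum_minus_one: "inversion_sum (- 1) \<in> K"
proof -
  obtain x :: 'a where x: "x \<notin> {0, 1, 1}"
    by (rule exists_notin_of_card_ge_4[OF card])
  define y where "y = 1 - inverse x"
  have y: "y \<noteq> 0" "y \<noteq> 1" "1 - y = inverse x" "1 - inverse y = inverse (1 - x)"
    using x by (auto simp: y_def divide_simps algebra_simps)
  have iy: "inverse y \<noteq> 0" "inverse y \<noteq> 1" using y by (auto simp: y_def)
  have cycle: "inversion_sum x + inversion_sum y + inversion_sum (1 - x) =
      (frag_of x + frag_of (1 - x)) + (frag_of y + frag_of (1 - y))
      + (frag_of (inverse y) + frag_of (1 - inverse y))"
    using x y(1,2) by (simp add: inversion_sum_def y(3,4) add_ac)
  have s: "inversion_sum x + inversion_sum y + inversion_sum (1 - x) \<in> K"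
    unfolding cycle using x y iy by (intro mem complement_sum) auto
  have m1: "inversion_sum (x * y) - inversion_sum x - inversion_sum y \<in> K"
    using x y by (intro inversion_sum_mult card) auto
  have xy: "x * y = - 1 * (1 - x)" using x by (simp add: y_def algebra_simps)
  have m2: "inversion_sum (x * y) - inversion_sum (- 1) - inversion_sum (1 - x) \<in> K"
    unfolding xy using x by (intro inversion_sum_mult card) auto
  have d: "inversion_sum (1 - x) + inversion_sum (1 - x) \<in> K"
    using x by (intro inversion_sum_double card) auto
  have "inversion_sum (- 1) = (inversion_sum x + inversion_sum y + inversion_sum (1 - x))
      + (inversion_sum (x * y) - inversion_sum x - inversion_sum y)
      - (inversion_sum (x * y) - inversion_sum (- 1) - inversion_sum (1 - x))
      - (inversion_sum (1 - x) + inversion_sum (1 - x))"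
    by (simp add: algebra_simps)
  also have "\<dots> \<in> K" by (intro mem s m1 m2 d)
  finally show ?thesis .
qed

lemma inversion_sum_square:
  assumes "y \<noteq> 0" "x = y * y \<or> x = - (y * y)"
  shows "inversion_sum x \<in> K"
proof -
  have s: "inversion_sum (y * y) \<in> K"
    using add_mem[OF inversion_sum_mult[OF card, of y y] inversion_sum_double[OF card, of y]] assms
    by simp
  have "inversion_sum (- 1 * (y * y)) - inversion_sum (- 1) - inversion_sum (y * y) \<in> K"
    using assms by (intro inversion_sum_mult card) auto
  from add_mem[OF this add_mem[OF inversion_sum_minus_one s]]
  have "inversion_sum (- (y * y)) \<in> K" by simp
  with s assms show ?thesis by auto
qed

end

section \<open>A mod 2 character separating an element from the squares up to sign\<close>

text \<open>
  Take a maximal multiplicative set of nonzero elements that contains \<open>-1\<close> and all nonzero squares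
  but not \<open>x\<close>. It is a subgroup, since \<open>u\<inverse> = u (u\<inverse>)\<^sup>2\<close>. Adjoining any further \<open>u\<close> captures \<open>x\<close>, so the
  complement is the single coset of \<open>x\<close> and the index is two. The equivalence in the conclusion says
  that membership is a homomorphism to a group of order two.
\<close>
lemma index_two_subgroup_avoiding:
  fixes x :: "'a::field"
  assumes x0: "x \<noteq> 0" and x: "\<And>y. y \<noteq> 0 \<Longrightarrow> x \<noteq> y * y \<and> x \<noteq> - (y * y)"
  obtains H where "\<And>u v. u \<noteq> 0 \<Longrightarrow> v \<noteq> 0 \<Longrightarrow> u * v \<in> H \<longleftrightarrow> (u \<in> H \<longleftrightarrow> v \<in> H)"
    and "- 1 \<in> H" and "x \<notin> H"
proof -
  define good where "good H \<longleftrightarrow> H \<subseteq> - {0} \<and> (\<forall>u\<in>H. \<forall>v\<in>H. u * v \<in> H) \<and>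
    (\<forall>y. y \<noteq> 0 \<longrightarrow> y * y \<in> H) \<and> - 1 \<in> H \<and> x \<notin> H" for H :: "'a set"
  define H0 :: "'a set" where "H0 = {z. \<exists>y. y \<noteq> 0 \<and> (z = y * y \<or> z = - (y * y))}"
  have "good H0"
    unfolding good_def
  proof (intro conjI ballI allI impI)
    show "H0 \<subseteq> - {0}" by (auto simp: H0_def)
    show "- 1 \<in> H0" by (auto simp: H0_def intro: exI[of _ 1])
    show "x \<notin> H0" using x by (auto simp: H0_def)
    show "y * y \<in> H0" if "y \<noteq> 0" for y using that by (auto simp: H0_def)
    show "u * v \<in> H0" if uv: "u \<in> H0" "v \<in> H0" for u v
    proof -
      from uv obtain a b where "a \<noteq> 0" "u = a * a \<or> u = - (a * a)"
        "b \<noteq> 0" "v = b * b \<or> v = - (b * b)" by (auto simp: H0_def)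
      then have "a * b \<noteq> 0" "u * v = (a * b) * (a * b) \<or> u * v = - ((a * b) * (a * b))"
        by (auto simp: algebra_simps)
      then show ?thesis unfolding H0_def by blast
    qed
  qed
  have "\<exists>H\<in>Collect good. \<forall>H'\<in>Collect good. H \<subseteq> H' \<longrightarrow> H' = H"
  proof (rule subset_Zorn_nonempty)
    show "Collect good \<noteq> {}" using \<open>good H0\<close> by auto
    fix \<C> assume ne: "\<C> \<noteq> {}" and ch: "subset.chain (Collect good) \<C>"
    have mem: "\<And>H. H \<in> \<C> \<Longrightarrow> good H" and tot: "\<And>H H'. H \<in> \<C> \<Longrightarrow> H' \<in> \<C> \<Longrightarrow> H \<subseteq> H' \<or> H' \<subseteq> H"
      using ch by (auto simp: subset.chain_def)
    have "u * v \<in> \<Union>\<C>" if "u \<in> \<Union>\<C>" "v \<in> \<Union>\<C>" for u v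
    proof -
      from that obtain H H' where H: "H \<in> \<C>" "u \<in> H" "H' \<in> \<C>" "v \<in> H'" by auto
      with tot[of H H'] obtain H'' where "H'' \<in> \<C>" "u \<in> H''" "v \<in> H''" by blast
      with mem[of H''] show ?thesis by (auto simp: good_def)
    qed
    moreover obtain H where H: "H \<in> \<C>" using ne by auto
    moreover have "\<Union>\<C> \<subseteq> - {0}" "x \<notin> \<Union>\<C>"
      using mem by (auto simp: good_def)
    moreover have "- 1 \<in> H" "\<forall>y. y \<noteq> 0 \<longrightarrow> y * y \<in> H"
      using mem[OF H] by (auto simp: good_def)
    ultimately have "good (\<Union>\<C>)"
      unfolding good_def by (intro conjI ballI allI impI) auto
    then show "\<Union>\<C> \<in> Collect good" by simp
  qed
  then obtain H where H: "good H" and max: "\<And>H'. good H' \<Longrightarrow> H \<subseteq> H' \<Longrightarrow> H' = H" by auto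
  have nz: "u \<noteq> 0" if "u \<in> H" for u using H that by (auto simp: good_def)
  have mult: "u * v \<in> H" if "u \<in> H" "v \<in> H" for u v using H that by (auto simp: good_def)
  have sq: "y * y \<in> H" if "y \<noteq> 0" for y using H that by (auto simp: good_def)
  have cancel: "v \<in> H" if "u * v \<in> H" "u \<in> H" for u v
  proof -
    have "(u * v) * u * (inverse u * inverse u) \<in> H"
      using mult[OF mult[OF that] sq[of "inverse u"]] nz[OF that(2)] by simp
    then show ?thesis using nz[OF that(2)] by (simp add: field_simps)
  qed
  have outside: "x * u \<in> H" if u: "u \<noteq> 0" "u \<notin> H" for u
  proof -
    define H' where "H' = H \<union> {u * h | h. h \<in> H}"
    have m: "a * b \<in> H'" if "a \<in> H'" "b \<in> H'" for a b
    proof -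
      have 1: "(u * h) * (u * h') \<in> H" if "h \<in> H" "h' \<in> H" for h h'
        using mult[OF sq[OF u(1)] mult[OF that]] by (simp add: mult_ac)
      from that consider "a \<in> H" "b \<in> H" | h where "a \<in> H" "h \<in> H" "b = u * h"
        | h where "h \<in> H" "a = u * h" "b \<in> H"
        | h h' where "h \<in> H" "h' \<in> H" "a = u * h" "b = u * h'"
        unfolding H'_def by blast
      then show ?thesis
      proof cases
        case 1
        then show ?thesis using mult by (simp add: H'_def)
      next
        case (2 h)
        then have "a * b = u * (a * h)" "a * h \<in> H" using mult by (simp_all add: mult_ac)
        then show ?thesis unfolding H'_def by blast
      next
        case (3 h)
        then have "a * b = u * (h * b)" "h * b \<in> H" using mult by (simp_all add: mult_ac)
        then show ?thesis unfolding H'_def by blast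
      next
        case (4 h h')
        then show ?thesis using 1 by (simp add: H'_def)
      qed
    qed
    have "1 \<in> H" using sq[of 1] by simp
    then have "u \<in> H'" by (auto simp: H'_def intro: exI[of _ 1])
    with u have "H' \<noteq> H" by auto
    then have "\<not> good H'" using max[of H'] by (auto simp: H'_def)
    moreover have "H' \<subseteq> - {0}" using nz u by (auto simp: H'_def)
    moreover have "- 1 \<in> H'" "\<And>y. y \<noteq> 0 \<Longrightarrow> y * y \<in> H'"
      using H by (auto simp: good_def H'_def)
    ultimately have "x \<in> H'"
      using m unfolding good_def by blast
    then obtain h where "h \<in> H" "x = u * h" using H by (auto simp: H'_def good_def)
    then show ?thesis using mult[OF sq[OF u(1)], of h] by (simp add: mult_ac)
  qed
  have "u * v \<in> H \<longleftrightarrow> (u \<in> H \<longleftrightarrow> v \<in> H)" if uv: "u \<noteq> 0" "v \<noteq> 0" for u v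
  proof (cases "u \<in> H \<or> v \<in> H")
    case True
    then show ?thesis
      using cancel[of u v] cancel[of v u] mult[of u v] by (auto simp: mult.commute)
  next
    case False
    have "(x * u) * (x * v) \<in> H"
      using False uv by (intro mult outside) auto
    then have "(x * x) * (u * v) \<in> H" by (simp add: mult_ac)
    then have "u * v \<in> H" using cancel[of "x * x"] sq[OF x0] by blast
    with False show ?thesis by blast
  qed
  then show ?thesis using H that by (auto simp: good_def)
qed

section \<open>The two quotients of the tensor square\<close>

lemma carrier_Funits: "carrier (Funits (F :: 'a::field itself)) = - {0}"
proof -
  have "\<exists>y. y * x = 1 \<and> x * y = 1" if "x \<noteq> 0" for x :: 'a
    using that by (intro exI[of _ "inverse x"]) simp
  then show ?thesis
    by (auto simp: Funits_def units_of_def Units_def ring_of_type_algebra_def)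
qed

lemma mult_Funits: "x \<otimes>\<^bsub>Funits F\<^esub> y = x * y"
  by (simp add: Funits_def units_of_def ring_of_type_algebra_def)

lemma kernel_free_Abelian_group:
  assumes "group_hom (free_Abelian_group B) G h"
  shows "closed_under_difference (kernel (free_Abelian_group B) G h)"
proof -
  interpret h: group_hom "free_Abelian_group B" G h by fact
  show ?thesis
  proof
    show "0 \<in> kernel (free_Abelian_group B) G h"
      using h.hom_one by (simp add: kernel_def)
    show "z - w \<in> kernel (free_Abelian_group B) G h"
      if "z \<in> kernel (free_Abelian_group B) G h" "w \<in> kernel (free_Abelian_group B) G h" for z w
      using that Poly_Mapping.keys_diff[of z w]
      by (auto simp: kernel_def free_Abelian_group_hom_diff[OF assms])
  qed
qed

abbreviation free_tensors :: "'a::field itself \<Rightarrow> ('a \<times> 'a \<Rightarrow>\<^sub>0 int) monoid" where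
  "free_tensors F \<equiv> free_Abelian_group (carrier (Funits F) \<times> carrier (Funits F))"

abbreviation free_symbols :: "'a::field itself \<Rightarrow> ('a \<Rightarrow>\<^sub>0 int) monoid" where
  "free_symbols F \<equiv> free_Abelian_group (Fflat F)"

definition tensor_class :: "'a::field itself \<Rightarrow> ('a \<times> 'a \<Rightarrow>\<^sub>0 int) \<Rightarrow> ('a \<times> 'a \<Rightarrow>\<^sub>0 int) set" where
  "tensor_class F = quotient_class (free_tensors F) (tensor_relators (Funits F) (Funits F))"

definition sigma_class :: "'a::field itself \<Rightarrow> ('a \<times> 'a \<Rightarrow>\<^sub>0 int) \<Rightarrow> ('a \<times> 'a \<Rightarrow>\<^sub>0 int) set set" where
  "sigma_class F z = quotient_class (tensor_square F) (sigma_relators F) (tensor_class F z)"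

definition wedge_class :: "'a::field itself \<Rightarrow> ('a \<times> 'a \<Rightarrow>\<^sub>0 int) \<Rightarrow> ('a \<times> 'a \<Rightarrow>\<^sub>0 int) set set" where
  "wedge_class F z = quotient_class (tensor_square F) (wedge_relators F) (tensor_class F z)"

definition suslin_class :: "'a::field itself \<Rightarrow> ('a \<Rightarrow>\<^sub>0 int) \<Rightarrow> ('a \<Rightarrow>\<^sub>0 int) set" where
  "suslin_class F = quotient_class (free_symbols F) (suslin_relators F)"

definition mod_c_class :: "'a::field itself \<Rightarrow> ('a \<Rightarrow>\<^sub>0 int) \<Rightarrow> ('a \<Rightarrow>\<^sub>0 int) set set" where
  "mod_c_class F z = quotient_class (pre_bloch F) {c_elem F} (suslin_class F z)"

definition bar_class :: "'a::field itself \<Rightarrow> ('a \<Rightarrow>\<^sub>0 int) \<Rightarrow> ('a \<Rightarrow>\<^sub>0 int) set" where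
  "bar_class F = quotient_class (free_symbols F) (bar_relators F)"

lemma keys_diff_diff:
  "Poly_Mapping.keys (frag_of a - frag_of b - frag_of c) \<subseteq> {a, b, c}"
  using Poly_Mapping.keys_diff[of "frag_of a - frag_of b" "frag_of c"]
    Poly_Mapping.keys_diff[of "frag_of a" "frag_of b"] by auto

lemma keys_add_frag_of:
  "Poly_Mapping.keys (frag_of a + frag_of b) \<subseteq> {a, b}"
  using Poly_Mapping.keys_add[of "frag_of a" "frag_of b"] by auto

lemma tensor_relators_Funits:
  "tensor_relators (Funits F) (Funits F) =
     {frag_of (x * x', y) - frag_of (x, y) - frag_of (x', y) | x x' y. x \<noteq> 0 \<and> x' \<noteq> 0 \<and> y \<noteq> 0} \<union>
     {frag_of (x, y * y') - frag_of (x, y) - frag_of (x, y') | x y y'. x \<noteq> 0 \<and> y \<noteq> 0 \<and> y' \<noteq> 0}"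
  by (simp add: tensor_relators_def carrier_Funits mult_Funits)

lemma tensor_relators_FunitsI:
  "\<lbrakk>x \<noteq> 0; x' \<noteq> 0; y \<noteq> 0\<rbrakk> \<Longrightarrow>
     frag_of (x * x', y) - frag_of (x, y) - frag_of (x', y) \<in> tensor_relators (Funits F) (Funits F)"
  "\<lbrakk>x \<noteq> 0; y \<noteq> 0; y' \<noteq> 0\<rbrakk> \<Longrightarrow>
     frag_of (x, y * y') - frag_of (x, y) - frag_of (x, y') \<in> tensor_relators (Funits F) (Funits F)"
  unfolding tensor_relators_Funits
   by (rule UnI1, rule CollectI, rule exI[of _ x], rule exI[of _ x'], rule exI[of _ y], simp)
      (rule UnI2, rule CollectI, rule exI[of _ x], rule exI[of _ y], rule exI[of _ y'], simp)

lemma tensor_relators_carrier: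
  "tensor_relators (Funits F) (Funits F) \<subseteq> carrier (free_tensors F)"
proof
  fix z assume "z \<in> tensor_relators (Funits F) (Funits F)"
  then obtain a b c where z: "z = frag_of a - frag_of b - frag_of c"
    and abc: "{a, b, c} \<subseteq> carrier (Funits F) \<times> carrier (Funits F)"
    unfolding tensor_relators_Funits carrier_Funits by fastforce
  show "z \<in> carrier (free_tensors F)"
    unfolding z carrier_free_Abelian_group_iff by (rule subset_trans[OF keys_diff_diff abc])
qed

lemma tensor_square_eq:
  "tensor_square F = quotient_by (free_tensors F) (tensor_relators (Funits F) (Funits F))"
  by (simp add: tensor_square_def tensor_def)

lemma tens_eq: "tens F x y = tensor_class F (frag_of (x, y))"
  by (simp add: tens_def pure_tensor_def tensor_class_def)

lemma tens_sigma_eq: "tens_sigma F x y = sigma_class F (frag_of (x, y))"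
  by (simp add: tens_sigma_def sigma_class_def tens_eq)

lemma wedge_eq: "wedge F x y = wedge_class F (frag_of (x, y))"
  by (simp add: wedge_def wedge_class_def tens_eq)

lemma comm_group_tensor_square: "comm_group (tensor_square F)"
  unfolding tensor_square_eq
  by (intro comm_group.quotient_by_comm_group abelian_free_Abelian_group tensor_relators_carrier)

lemma tensor_class_group_hom: "group_hom (free_tensors F) (tensor_square F) (tensor_class F)"
  unfolding tensor_square_eq tensor_class_def
  by (intro comm_group.quotient_class_group_hom abelian_free_Abelian_group tensor_relators_carrier)

lemma tensor_class_image: "carrier (tensor_square F) = tensor_class F ` carrier (free_tensors F)"
  unfolding tensor_square_eq tensor_class_def
  by (intro comm_group.carrier_quotient_by abelian_free_Abelian_group)

definition skew_relators :: "'a::field itself \<Rightarrow> ('a \<times> 'a \<Rightarrow>\<^sub>0 int) set" where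
  "skew_relators F = {frag_of (x, y) + frag_of (y, x) | x y. x \<noteq> 0 \<and> y \<noteq> 0}"

lemma skew_relators_carrier: "skew_relators F \<subseteq> carrier (free_tensors F)"
  using keys_add_frag_of by (fastforce simp: skew_relators_def carrier_Funits)

lemma sigma_relators_eq: "sigma_relators F = tensor_class F ` skew_relators F"
proof -
  have "tens F x y \<otimes>\<^bsub>tensor_square F\<^esub> tens F y x = tensor_class F (frag_of (x, y) + frag_of (y, x))"
    if "x \<noteq> 0" "y \<noteq> 0" for x y
    using that by (simp add: tens_eq carrier_Funits free_Abelian_group_hom_add[OF tensor_class_group_hom])
  then show ?thesis
    by (fastforce simp: sigma_relators_def skew_relators_def carrier_Funits)
qed

definition twisted_diagonal :: "'a::field itself \<Rightarrow> ('a \<times> 'a \<Rightarrow>\<^sub>0 int) set" where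
  "twisted_diagonal F = {frag_of (- x, x) | x. x \<noteq> 0}"

lemma twisted_diagonal_carrier: "twisted_diagonal F \<subseteq> carrier (free_tensors F)"
  by (auto simp: twisted_diagonal_def carrier_Funits)

lemma wedge_relators_eq: "wedge_relators F = tensor_class F ` twisted_diagonal F"
  by (auto simp: wedge_relators_def twisted_diagonal_def carrier_Funits tens_eq)

lemma tensor_class_closed: "S \<subseteq> carrier (free_tensors F) \<Longrightarrow> tensor_class F ` S \<subseteq> carrier (tensor_square F)"
  unfolding tensor_class_image by blast

text \<open>
  The skew tensor square and the modified exterior square only differ in the set \<open>S\<close> of additional
  relators. The last part describes the kernel by generators in the free abelian group, so that a
  property of its elements needs to be checked on the tensor relators and on \<open>S\<close> only.
\<close>
lemma tensor_quotient:
  assumes S: "S \<subseteq> carrier (free_tensors F)"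
  defines "q \<equiv> \<lambda>z. quotient_class (tensor_square F) (tensor_class F ` S) (tensor_class F z)"
    and "Q \<equiv> quotient_by (tensor_square F) (tensor_class F ` S)"
  shows "comm_group Q" "group_hom (free_tensors F) Q q" "carrier Q = q ` carrier (free_tensors F)"
    "z \<in> kernel (free_tensors F) Q q \<longleftrightarrow>
       z \<in> generate (free_tensors F) (tensor_relators (Funits F) (Funits F) \<union> S)"
proof -
  interpret comm_group "tensor_square F" by (rule comm_group_tensor_square)
  note S' = tensor_class_closed[OF S]
  show "comm_group Q" unfolding Q_def by (rule quotient_by_comm_group[OF S'])
  show "group_hom (free_tensors F) Q q"
    unfolding Q_def q_def
    by (rule group_hom_compose[OF tensor_class_group_hom quotient_class_group_hom[OF S']])
  show "carrier Q = q ` carrier (free_tensors F)"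
    unfolding Q_def q_def carrier_quotient_by tensor_class_image by (simp add: image_image)
  have "z \<in> generate (free_tensors F) (tensor_relators (Funits F) (Funits F) \<union> S) \<Longrightarrow>
      z \<in> carrier (free_tensors F)"
    using S tensor_relators_carrier[of F]
      group.generate_in_carrier[OF group_free_Abelian_group, of "tensor_relators (Funits F) (Funits F) \<union> S"]
    by blast
  then show "z \<in> kernel (free_tensors F) Q q \<longleftrightarrow>
       z \<in> generate (free_tensors F) (tensor_relators (Funits F) (Funits F) \<union> S)"
    using comm_group.quotient_quotient_class_eq_one_iff[OF abelian_free_Abelian_group
        tensor_relators_carrier S, of z]
    unfolding kernel_def Q_def q_def tensor_class_def tensor_square_eq by blast
qed

lemmas tensor_sigma_quotient = tensor_quotient[OF skew_relators_carrier,
    folded sigma_relators_eq, folded sigma_class_def tensor_sigma_def]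

lemmas wedge_square_quotient = tensor_quotient[OF twisted_diagonal_carrier,
    folded wedge_relators_eq, folded wedge_class_def wedge_square_def]

definition sigma_kernel :: "'a::field itself \<Rightarrow> ('a \<times> 'a \<Rightarrow>\<^sub>0 int) set" where
  "sigma_kernel F = kernel (free_tensors F) (tensor_sigma F) (sigma_class F)"

definition wedge_kernel :: "'a::field itself \<Rightarrow> ('a \<times> 'a \<Rightarrow>\<^sub>0 int) set" where
  "wedge_kernel F = kernel (free_tensors F) (wedge_square F) (wedge_class F)"

lemma sigma_skew_relations: "skew_relations (sigma_kernel F)"
proof -
  interpret closed_under_difference "sigma_kernel F"
    unfolding sigma_kernel_def by (rule kernel_free_Abelian_group[OF tensor_sigma_quotient(2)])
  have "z \<in> sigma_kernel F" if "z \<in> tensor_relators (Funits F) (Funits F) \<union> skew_relators F" for z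
    using that unfolding sigma_kernel_def tensor_sigma_quotient(4) by (rule generate.incl)
  then show ?thesis
    by unfold_locales (auto intro!: tensor_relators_FunitsI simp: skew_relators_def)
qed

lemma twisted_diagonal_wedge_kernel: "x \<noteq> 0 \<Longrightarrow> frag_of (- x, x) \<in> wedge_kernel F"
  unfolding wedge_kernel_def wedge_square_quotient(4)
  by (rule generate.incl) (auto simp: twisted_diagonal_def)

lemma wedge_skew_relations: "skew_relations (wedge_kernel F)"
proof -
  interpret closed_under_difference "wedge_kernel F"
    unfolding wedge_kernel_def by (rule kernel_free_Abelian_group[OF wedge_square_quotient(2)])
  have "z \<in> wedge_kernel F" if "z \<in> tensor_relators (Funits F) (Funits F)" for z
    using that unfolding wedge_kernel_def wedge_square_quotient(4) by (auto intro: generate.incl)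
  then interpret bilinear_relations "wedge_kernel F"
    by unfold_locales (auto intro!: tensor_relators_FunitsI)
  show ?thesis
    by unfold_locales (rule skew_of_wedge[OF twisted_diagonal_wedge_kernel])
qed

text \<open>
  If \<open>x\<close> is not a square up to sign, let \<open>\<phi>\<close> be the homomorphism to \<open>\<int>/2\<close> with \<open>\<phi>(x) = 1\<close> and
  \<open>\<phi>(-1) = 0\<close>. The symmetric bilinear form \<open>\<phi>(u) \<phi>(v)\<close> kills the skew relations modulo \<open>2\<close> and takes
  the value \<open>\<phi>(x) \<phi>(-x) = 1\<close> at \<open>x \<otimes> (-x)\<close>.
\<close>
lemma neg_tensor_in_sigma_kernel:
  fixes F :: "'a::field itself"
  assumes "x \<noteq> 0" and mem: "frag_of (x, - x) \<in> sigma_kernel F"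
  obtains y where "y \<noteq> 0" "x = y * y \<or> x = - (y * y)"
proof (rule ccontr)
  assume "\<not> thesis"
  then have "\<And>y. y \<noteq> 0 \<Longrightarrow> x \<noteq> y * y \<and> x \<noteq> - (y * y)" using that by blast
  then obtain H where H: "\<And>u v. u \<noteq> 0 \<Longrightarrow> v \<noteq> 0 \<Longrightarrow> u * v \<in> H \<longleftrightarrow> (u \<in> H \<longleftrightarrow> v \<in> H)"
    and H1: "- 1 \<in> H" and xH: "x \<notin> H"
    using index_two_subgroup_avoiding[OF assms(1)] by metis
  \<comment> \<open>The integer-valued lift of the form: the sum of the coefficients at pairs outside \<open>H\<close>.\<close>
  define e where "e z = Poly_Mapping.lookup
    (frag_extend (\<lambda>(u, v). if u \<notin> H \<and> v \<notin> H then frag_of () else 0) z) ()"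
    for z :: "'a \<times> 'a \<Rightarrow>\<^sub>0 int"
  have e: "e 0 = 0" "e (z + w) = e z + e w" "e (z - w) = e z - e w" "e (- z) = - e z" for z w
    by (simp_all add: e_def frag_extend_add frag_extend_diff frag_extend_minus
        lookup_add lookup_minus)
  have e_of: "e (frag_of (u, v)) = (if u \<notin> H \<and> v \<notin> H then 1 else 0)" for u v
    by (simp add: e_def)
  define E where "E = {z \<in> carrier (free_tensors F). even (e z)}"
  have "subgroup E (free_tensors F)"
  proof (rule group.subgroupI[OF group_free_Abelian_group])
    show "E \<subseteq> carrier (free_tensors F)" by (auto simp: E_def)
    show "E \<noteq> {}" using e(1) by (auto simp: E_def intro!: exI[of _ 0])
    show "inv\<^bsub>free_tensors F\<^esub> z \<in> E" if "z \<in> E" for z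
      using that by (auto simp: E_def e)
    show "z \<otimes>\<^bsub>free_tensors F\<^esub> w \<in> E" if "z \<in> E" "w \<in> E" for z w
      using that Poly_Mapping.keys_add[of z w] by (auto simp: E_def e)
  qed
  moreover have "tensor_relators (Funits F) (Funits F) \<union> skew_relators F \<subseteq> E"
  proof
    fix z assume z: "z \<in> tensor_relators (Funits F) (Funits F) \<union> skew_relators F"
    then have "z \<in> carrier (free_tensors F)"
      using tensor_relators_carrier skew_relators_carrier by blast
    moreover have "even (e z)"
      using z unfolding tensor_relators_Funits skew_relators_def
      by (auto simp: e e_of H)
    ultimately show "z \<in> E" by (simp add: E_def)
  qed
  ultimately have "generate (free_tensors F) (tensor_relators (Funits F) (Funits F) \<union> skew_relators F) \<subseteq> E"
    by (intro group.generate_subgroup_incl[OF group_free_Abelian_group])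
  then have "even (e (frag_of (x, - x)))"
    using mem unfolding sigma_kernel_def tensor_sigma_quotient(4) by (auto simp: E_def)
  moreover have "- x \<notin> H"
    using H[of "- 1" x] H1 xH assms(1) by simp
  ultimately show False using xH by (simp add: e_of)
qed

section \<open>The two groups of symbols\<close>

lemma suslin_relators_eq:
  "suslin_relators F = {five_term x y | x y. x \<in> Fflat F \<and> y \<in> Fflat F \<and> x \<noteq> y}"
  by (simp add: suslin_relators_def five_term_def)

lemma five_term_arguments:
  assumes "x \<in> Fflat F" "y \<in> Fflat F" "x \<noteq> y"
  shows "{x, y, y / x, (1 - x) / (1 - y), (1 - inverse x) / (1 - inverse y)} \<subseteq> Fflat F"
  using assms by (auto simp: Fflat_def divide_simps) (simp add: algebra_simps)

lemma five_term_keys: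
  assumes "x \<in> Fflat F" "y \<in> Fflat F" "x \<noteq> y"
  shows "five_term x y \<in> carrier (free_symbols F)"
proof -
  have c: "a + b \<in> carrier (free_symbols F)" "a - b \<in> carrier (free_symbols F)"
    if "a \<in> carrier (free_symbols F)" "b \<in> carrier (free_symbols F)" for a b
    using that Poly_Mapping.keys_add[of a b] Poly_Mapping.keys_diff[of a b] by auto
  show ?thesis
    unfolding five_term_def using five_term_arguments[OF assms]
    by (intro c) simp_all
qed

lemma inversion_sum_keys: "x \<noteq> 0 \<Longrightarrow> inversion_sum x \<in> carrier (free_symbols F)"
  using keys_add_frag_of[of x "inverse x"] by (auto simp: inversion_sum_def Fflat_def)

lemma complement_sum_keys: "x \<in> Fflat F \<Longrightarrow> frag_of x + frag_of (1 - x) \<in> carrier (free_symbols F)"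
  using keys_add_frag_of[of x "1 - x"] by (auto simp: Fflat_def)

lemma suslin_relators_carrier: "suslin_relators F \<subseteq> carrier (free_symbols F)"
  unfolding suslin_relators_eq using five_term_keys by blast

lemma bar_five_term_eq:
  assumes "x \<in> Fflat F" "y \<in> Fflat F" "x \<noteq> y"
  shows "frag_of x - frag_of y + frag_of (y / x) - frag_of ((1 - y) / (1 - x))
        + frag_of ((1 - inverse y) / (1 - inverse x)) =
      five_term x y - inversion_sum ((1 - x) / (1 - y))
        + inversion_sum ((1 - inverse x) / (1 - inverse y))"
  using five_term_arguments[OF assms]
  by (simp add: five_term_def inversion_sum_def Fflat_def)

lemma bar_relators_eq:
  "bar_relators F =
     {five_term x y - inversion_sum ((1 - x) / (1 - y))
        + inversion_sum ((1 - inverse x) / (1 - inverse y)) | x y.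
        x \<in> Fflat F \<and> y \<in> Fflat F \<and> x \<noteq> y} \<union>
     inversion_sum ` Fflat F \<union>
     {frag_of y + frag_of (1 - y) | y. y \<in> Fflat F}"
proof -
  have "{frag_of x + frag_of (inverse x) | x. x \<in> Fflat F} = inversion_sum ` Fflat F"
    by (fastforce simp: inversion_sum_def Fflat_def)
  moreover have "{frag_of x - frag_of y + frag_of (y / x) - frag_of ((1 - y) / (1 - x))
        + frag_of ((1 - inverse y) / (1 - inverse x)) | x y.
        x \<in> Fflat F \<and> y \<in> Fflat F \<and> x \<noteq> y} =
     {five_term x y - inversion_sum ((1 - x) / (1 - y))
        + inversion_sum ((1 - inverse x) / (1 - inverse y)) | x y.
        x \<in> Fflat F \<and> y \<in> Fflat F \<and> x \<noteq> y}"
    by (intro Collect_cong arg_cong[where f = Ex] ext) (auto simp: bar_five_term_eq)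
  ultimately show ?thesis by (simp add: bar_relators_def)
qed

text \<open>
  The two versions of the five-term relation differ only by inversion sums.
\<close>
lemma bar_relators_in_subgroup:
  assumes "closed_under_difference M"
    and inv: "\<And>x. x \<noteq> 0 \<Longrightarrow> inversion_sum x \<in> M"
    and comp: "\<And>x. x \<in> Fflat F \<Longrightarrow> frag_of x + frag_of (1 - x) \<in> M"
    and five: "\<And>x y. x \<in> Fflat F \<Longrightarrow> y \<in> Fflat F \<Longrightarrow> x \<noteq> y \<Longrightarrow> five_term x y \<in> M"
  shows "bar_relators F \<subseteq> M"
proof -
  interpret closed_under_difference M by fact
  have "five_term x y - inversion_sum ((1 - x) / (1 - y))
        + inversion_sum ((1 - inverse x) / (1 - inverse y)) \<in> M"
    if "x \<in> Fflat F" "y \<in> Fflat F" "x \<noteq> y" for x y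
    using five_term_arguments[OF that] that
    by (intro add_mem diff_mem five inv) (auto simp: Fflat_def)
  then show ?thesis
    unfolding bar_relators_eq using inv comp by (auto simp: Fflat_def)
qed

lemma additive_subgroup_carrier: "closed_under_difference (carrier (free_Abelian_group B))"
proof
  show "z - w \<in> carrier (free_Abelian_group B)"
    if "z \<in> carrier (free_Abelian_group B)" "w \<in> carrier (free_Abelian_group B)" for z w
    using that Poly_Mapping.keys_diff[of z w] by auto
qed simp

lemma bar_relators_carrier: "bar_relators F \<subseteq> carrier (free_symbols F)"
  by (intro bar_relators_in_subgroup additive_subgroup_carrier inversion_sum_keys
      complement_sum_keys five_term_keys)

lemma bar_class_group_hom: "group_hom (free_symbols F) (pre_bloch_bar F) (bar_class F)"
  unfolding pre_bloch_bar_def bar_class_def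
  by (intro comm_group.quotient_class_group_hom abelian_free_Abelian_group bar_relators_carrier)

lemma comm_group_pre_bloch_bar: "comm_group (pre_bloch_bar F)"
  unfolding pre_bloch_bar_def
  by (intro comm_group.quotient_by_comm_group abelian_free_Abelian_group bar_relators_carrier)

lemma carrier_pre_bloch_bar: "carrier (pre_bloch_bar F) = bar_class F ` carrier (free_symbols F)"
  unfolding pre_bloch_bar_def bar_class_def
  by (intro comm_group.carrier_quotient_by abelian_free_Abelian_group)

lemma bar_class_eq_one_iff:
  "z \<in> carrier (free_symbols F) \<Longrightarrow>
     bar_class F z = \<one>\<^bsub>pre_bloch_bar F\<^esub> \<longleftrightarrow> z \<in> generate (free_symbols F) (bar_relators F)"
  unfolding pre_bloch_bar_def bar_class_def
  by (intro comm_group.quotient_class_eq_one_iff abelian_free_Abelian_group bar_relators_carrier)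

lemma suslin_class_group_hom: "group_hom (free_symbols F) (pre_bloch F) (suslin_class F)"
  unfolding pre_bloch_def suslin_class_def
  by (intro comm_group.quotient_class_group_hom abelian_free_Abelian_group suslin_relators_carrier)

lemma comm_group_pre_bloch: "comm_group (pre_bloch F)"
  unfolding pre_bloch_def
  by (intro comm_group.quotient_by_comm_group abelian_free_Abelian_group suslin_relators_carrier)

lemma carrier_pre_bloch: "carrier (pre_bloch F) = suslin_class F ` carrier (free_symbols F)"
  unfolding pre_bloch_def suslin_class_def
  by (intro comm_group.carrier_quotient_by abelian_free_Abelian_group)

lemma suslin_class_five_term:
  assumes "x \<in> Fflat F" "y \<in> Fflat F" "x \<noteq> y"
  shows "suslin_class F (five_term x y) = \<one>\<^bsub>pre_bloch F\<^esub>"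
  unfolding suslin_class_def pre_bloch_def
    comm_group.quotient_class_eq_one_iff[OF abelian_free_Abelian_group suslin_relators_carrier
      five_term_keys[OF assms]]
  by (rule generate.incl) (use assms in \<open>auto simp: suslin_relators_eq\<close>)

lemma bloch_sym_eq: "bloch_sym F x = suslin_class F (frag_of x)"
  by (simp add: bloch_sym_def suslin_class_def)

lemma bloch_sym_mod_c_eq: "bloch_sym_mod_c F x = mod_c_class F (frag_of x)"
  by (simp add: bloch_sym_mod_c_def mod_c_class_def bloch_sym_eq)

lemma bloch_sym_bar_eq: "bloch_sym_bar F x = bar_class F (frag_of x)"
  by (simp add: bloch_sym_bar_def bar_class_def)

section \<open>The induced maps on representatives\<close>

lemma one_minus_tensor_group_hom: "group_hom (free_symbols F) (free_tensors F) one_minus_tensor"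
  unfolding one_minus_tensor_def
  by (rule frag_extend_group_hom) (auto simp: Fflat_def carrier_Funits)

lemma one_minus_tensor_closed:
  "z \<in> carrier (free_symbols F) \<Longrightarrow> one_minus_tensor z \<in> carrier (free_tensors F)"
  by (rule group_hom.hom_closed[OF one_minus_tensor_group_hom])

locale field_card_ge_4 =
  fixes F :: "'a::field itself"
  assumes card: "infinite (UNIV :: 'a set) \<or> card (UNIV :: 'a set) \<ge> 4"
begin

sublocale sigma: skew_relations "sigma_kernel F" by (rule sigma_skew_relations)
sublocale wedge: skew_relations "wedge_kernel F" by (rule wedge_skew_relations)

lemma c_elem_representative:
  obtains x where "x \<in> Fflat F" "c_elem F = suslin_class F (frag_of x + frag_of (1 - x))"
proof -
  obtain v :: 'a where "v \<notin> {0, 1, 1}" by (rule exists_notin_of_card_ge_4[OF card])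
  then have "v \<in> Fflat F" by (simp add: Fflat_def)
  define x where "x = (SOME x. x \<in> Fflat F)"
  have x: "x \<in> Fflat F" unfolding x_def by (rule someI) fact
  have "c_elem F = suslin_class F (frag_of x + frag_of (1 - x))"
    using x unfolding c_elem_def Let_def bloch_sym_eq x_def[symmetric]
    by (subst free_Abelian_group_hom_add[OF suslin_class_group_hom]) (auto simp: Fflat_def)
  with x that show ?thesis by blast
qed

lemma c_elem_closed: "c_elem F \<in> carrier (pre_bloch F)"
proof -
  obtain x where x: "x \<in> Fflat F" "c_elem F = suslin_class F (frag_of x + frag_of (1 - x))"
    by (rule c_elem_representative)
  then show ?thesis
    unfolding carrier_pre_bloch using complement_sum_keys by blast
qed

lemma comm_group_pre_bloch_mod_c: "comm_group (pre_bloch_mod_c F)"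
  unfolding pre_bloch_mod_c_def
  by (rule comm_group.quotient_by_comm_group[OF comm_group_pre_bloch]) (simp add: c_elem_closed)

lemma mod_c_quotient_group_hom:
  "group_hom (pre_bloch F) (pre_bloch_mod_c F) (quotient_class (pre_bloch F) {c_elem F})"
  unfolding pre_bloch_mod_c_def
  by (rule comm_group.quotient_class_group_hom[OF comm_group_pre_bloch]) (simp add: c_elem_closed)

lemma mod_c_class_group_hom: "group_hom (free_symbols F) (pre_bloch_mod_c F) (mod_c_class F)"
  unfolding mod_c_class_def[abs_def]
  by (rule group_hom_compose[OF suslin_class_group_hom mod_c_quotient_group_hom])

lemma carrier_pre_bloch_mod_c:
  "carrier (pre_bloch_mod_c F) = mod_c_class F ` carrier (free_symbols F)"
  unfolding pre_bloch_mod_c_def mod_c_class_def[abs_def]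
    comm_group.carrier_quotient_by[OF comm_group_pre_bloch] carrier_pre_bloch
  by (simp add: image_image)

definition mod_c_kernel :: "('a \<Rightarrow>\<^sub>0 int) set" where
  "mod_c_kernel = kernel (free_symbols F) (pre_bloch_mod_c F) (mod_c_class F)"

text \<open>
  One sum \<open>[x] + [1 - x]\<close> represents \<open>c\<^sub>F\<close>; the others agree with it modulo five-term relations, so
  all of them vanish.
\<close>
sublocale symbols: reduced_suslin_relations mod_c_kernel
proof -
  interpret closed_under_difference mod_c_kernel
    unfolding mod_c_kernel_def by (rule kernel_free_Abelian_group[OF mod_c_class_group_hom])
  interpret q: group_hom "pre_bloch F" "pre_bloch_mod_c F" "quotient_class (pre_bloch F) {c_elem F}"
    by (rule mod_c_quotient_group_hom)
  interpret suslin_relations mod_c_kernel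
  proof
    fix x y :: 'a assume "x \<noteq> 0" "x \<noteq> 1" "y \<noteq> 0" "y \<noteq> 1" "x \<noteq> y"
    then have xy: "x \<in> Fflat F" "y \<in> Fflat F" "x \<noteq> y" by (auto simp: Fflat_def)
    then show "five_term x y \<in> mod_c_kernel"
      using five_term_keys[OF xy]
      by (simp add: mod_c_kernel_def kernel_def mod_c_class_def suslin_class_five_term)
  qed
  obtain x where x: "x \<in> Fflat F" "c_elem F = suslin_class F (frag_of x + frag_of (1 - x))"
    by (rule c_elem_representative)
  have "quotient_class (pre_bloch F) {c_elem F} (c_elem F) = \<one>\<^bsub>pre_bloch_mod_c F\<^esub>"
    unfolding pre_bloch_mod_c_def using c_elem_closed
    by (subst comm_group.quotient_class_eq_one_iff[OF comm_group_pre_bloch])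
       (auto intro: generate.incl)
  then have c: "frag_of x + frag_of (1 - x) \<in> mod_c_kernel"
    using x complement_sum_keys[OF x(1)]
    unfolding mod_c_kernel_def kernel_def mod_c_class_def by simp
  show "reduced_suslin_relations mod_c_kernel"
  proof
    fix y :: 'a assume y: "y \<noteq> 0" "y \<noteq> 1"
    have "(frag_of y + frag_of (1 - y)) - (frag_of x + frag_of (1 - x)) \<in> mod_c_kernel"
      using x y by (intro complement_sum_const) (auto simp: Fflat_def)
    from add_mem[OF this c] show "frag_of y + frag_of (1 - y) \<in> mod_c_kernel" by simp
  qed (rule card)
qed

lemma mod_c_kernelD: "z \<in> mod_c_kernel \<Longrightarrow> mod_c_class F z = \<one>\<^bsub>pre_bloch_mod_c F\<^esub>"
  by (simp add: mod_c_kernel_def kernel_def)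

lemma sigma_kernelD: "z \<in> sigma_kernel F \<Longrightarrow> sigma_class F z = \<one>\<^bsub>tensor_sigma F\<^esub>"
  by (simp add: sigma_kernel_def kernel_def)

lemma wedge_kernelD: "z \<in> wedge_kernel F \<Longrightarrow> wedge_class F z = \<one>\<^bsub>wedge_square F\<^esub>"
  by (simp add: wedge_kernel_def kernel_def)

text \<open>
  Both maps of the theorem are of this shape: a homomorphism prescribed on symbols descends to the
  Bloch group modulo \<open>c\<^sub>F\<close> once it kills the five-term relations and the sums \<open>[x] + [1 - x]\<close>.
\<close>
lemma induced_from_pre_bloch_mod_c:
  assumes G: "comm_group G" and h: "group_hom (free_symbols F) G h"
    and five: "\<And>x y. \<lbrakk>x \<in> Fflat F; y \<in> Fflat F; x \<noteq> y\<rbrakk> \<Longrightarrow> h (five_term x y) = \<one>\<^bsub>G\<^esub>"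
    and comp: "\<And>x. x \<in> Fflat F \<Longrightarrow> h (frag_of x + frag_of (1 - x)) = \<one>\<^bsub>G\<^esub>"
    and f: "\<And>x. x \<in> Fflat F \<Longrightarrow> h (frag_of x) = f x"
  shows "group_hom (pre_bloch F) G (induced_map (free_ext G f))"
    and "z \<in> carrier (free_symbols F) \<Longrightarrow> induced_map (free_ext G f) (suslin_class F z) = h z"
    and "group_hom (pre_bloch_mod_c F) G (induced_map (induced_map (free_ext G f)))"
    and "z \<in> carrier (free_symbols F) \<Longrightarrow>
           induced_map (induced_map (free_ext G f)) (mod_c_class F z) = h z"
    and "induced_map (free_ext G f) (c_elem F) = \<one>\<^bsub>G\<^esub>"
proof -
  interpret G: comm_group G by fact
  interpret h: group_hom "free_symbols F" G h by fact
  have "f x \<in> carrier G" if "x \<in> Fflat F" for x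
    using that h.hom_closed[of "frag_of x"] f by simp
  then have fc: "f ` Fflat F \<subseteq> carrier G" by blast
  note hom0 = G.free_ext_group_hom[OF fc]
  have eq: "free_ext G f z = h z" if "z \<in> carrier (free_symbols F)" for z
  proof (rule free_Abelian_group_hom_cong[OF hom0 h])
    show "free_ext G f (frag_of x) = h (frag_of x)" if "x \<in> Fflat F" for x
      using that f fc G.free_ext_frag_of[of f x] by auto
  qed (use that in simp)
  have kills: "free_ext G f s = \<one>\<^bsub>G\<^esub>" if "s \<in> suslin_relators F" for s
    using that five eq[OF subsetD[OF suslin_relators_carrier that]]
    by (auto simp: suslin_relators_eq)
  show hom1: "group_hom (pre_bloch F) G (induced_map (free_ext G f))"
    unfolding pre_bloch_def
    by (rule comm_group.induced_map_group_hom[OF abelian_free_Abelian_group suslin_relators_carrier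
          hom0 kills])
  show eq1: "induced_map (free_ext G f) (suslin_class F z) = h z"
    if "z \<in> carrier (free_symbols F)" for z
    unfolding suslin_class_def
    using comm_group.induced_map_quotient_class[OF abelian_free_Abelian_group
        suslin_relators_carrier hom0 kills that] eq[OF that] by simp
  show c: "induced_map (free_ext G f) (c_elem F) = \<one>\<^bsub>G\<^esub>"
  proof -
    obtain x where x: "x \<in> Fflat F" "c_elem F = suslin_class F (frag_of x + frag_of (1 - x))"
      by (rule c_elem_representative)
    then show ?thesis using eq1[OF complement_sum_keys[OF x(1)]] comp by simp
  qed
  have c_sub: "{c_elem F} \<subseteq> carrier (pre_bloch F)" by (simp add: c_elem_closed)
  have c': "induced_map (free_ext G f) s = \<one>\<^bsub>G\<^esub>" if "s \<in> {c_elem F}" for s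
    using that c by simp
  show "group_hom (pre_bloch_mod_c F) G (induced_map (induced_map (free_ext G f)))"
    unfolding pre_bloch_mod_c_def
    by (rule comm_group.induced_map_group_hom[OF comm_group_pre_bloch c_sub hom1 c'])
  show "induced_map (induced_map (free_ext G f)) (mod_c_class F z) = h z"
    if z: "z \<in> carrier (free_symbols F)"
  proof -
    have "suslin_class F z \<in> carrier (pre_bloch F)" using z carrier_pre_bloch by blast
    from comm_group.induced_map_quotient_class[OF comm_group_pre_bloch c_sub hom1 c' this]
    show ?thesis unfolding mod_c_class_def using eq1[OF z] by simp
  qed
qed

subsection \<open>The map to the skew tensor square\<close>

lemma sigma_one_minus_tensor_group_hom:
  "group_hom (free_symbols F) (tensor_sigma F) (\<lambda>z. sigma_class F (one_minus_tensor z))"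
  by (rule group_hom_compose[OF one_minus_tensor_group_hom tensor_sigma_quotient(2)])

lemmas suslin_map_facts = induced_from_pre_bloch_mod_c[OF tensor_sigma_quotient(1)
  sigma_one_minus_tensor_group_hom, of "\<lambda>x. tens_sigma F x (1 - x)",
  folded suslin_map_def, folded suslin_map_mod_c_def]

lemma suslin_map_wd:
  shows "\<lbrakk>x \<in> Fflat F; y \<in> Fflat F; x \<noteq> y\<rbrakk> \<Longrightarrow>
      sigma_class F (one_minus_tensor (five_term x y)) = \<one>\<^bsub>tensor_sigma F\<^esub>"
    and "x \<in> Fflat F \<Longrightarrow>
      sigma_class F (one_minus_tensor (frag_of x + frag_of (1 - x))) = \<one>\<^bsub>tensor_sigma F\<^esub>"
    and "sigma_class F (one_minus_tensor (frag_of x)) = tens_sigma F x (1 - x)"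
    by (auto intro!: sigma_kernelD sigma.one_minus_tensor_five_term sigma.skew
        simp: Fflat_def tens_sigma_eq)

lemma suslin_map:
  shows "group_hom (pre_bloch F) (tensor_sigma F) (suslin_map F)"
    and "z \<in> carrier (free_symbols F) \<Longrightarrow>
      suslin_map F (suslin_class F z) = sigma_class F (one_minus_tensor z)"
    and "group_hom (pre_bloch_mod_c F) (tensor_sigma F) (suslin_map_mod_c F)"
    and "z \<in> carrier (free_symbols F) \<Longrightarrow>
      suslin_map_mod_c F (mod_c_class F z) = sigma_class F (one_minus_tensor z)"
    and "suslin_map F (c_elem F) = \<one>\<^bsub>tensor_sigma F\<^esub>"
  by (rule suslin_map_facts[OF suslin_map_wd]; assumption)+

subsection \<open>The natural map\<close>

definition bar_kernel :: "('a \<Rightarrow>\<^sub>0 int) set" where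
  "bar_kernel = kernel (free_symbols F) (pre_bloch_bar F) (bar_class F)"

sublocale bar: closed_under_difference bar_kernel
  unfolding bar_kernel_def by (rule kernel_free_Abelian_group[OF bar_class_group_hom])

lemma bar_kernelD: "z \<in> bar_kernel \<Longrightarrow> bar_class F z = \<one>\<^bsub>pre_bloch_bar F\<^esub>"
  by (simp add: bar_kernel_def kernel_def)

lemma bar_relators_kernel: "bar_relators F \<subseteq> bar_kernel"
proof
  fix z assume "z \<in> bar_relators F"
  moreover from this have "z \<in> carrier (free_symbols F)"
    using bar_relators_carrier by blast
  ultimately show "z \<in> bar_kernel"
    by (simp add: bar_kernel_def kernel_def bar_class_eq_one_iff generate.incl)
qed

lemma inversion_sum_bar_kernel: "x \<noteq> 0 \<Longrightarrow> inversion_sum x \<in> bar_kernel"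
  using bar_relators_kernel bar.zero_mem
  by (cases "x = 1") (auto simp: bar_relators_eq Fflat_def)

lemma complement_sum_bar_kernel: "x \<in> Fflat F \<Longrightarrow> frag_of x + frag_of (1 - x) \<in> bar_kernel"
  using bar_relators_kernel by (auto simp: bar_relators_eq)

lemma five_term_bar_kernel:
  assumes "x \<in> Fflat F" "y \<in> Fflat F" "x \<noteq> y"
  shows "five_term x y \<in> bar_kernel"
proof -
  let ?u = "(1 - x) / (1 - y)" and ?v = "(1 - inverse x) / (1 - inverse y)"
  have "five_term x y - inversion_sum ?u + inversion_sum ?v \<in> bar_kernel"
    using bar_relators_kernel assms unfolding bar_relators_eq by blast
  moreover have "inversion_sum ?u \<in> bar_kernel" "inversion_sum ?v \<in> bar_kernel"
    using five_term_arguments[OF assms] by (auto intro!: inversion_sum_bar_kernel simp: Fflat_def)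
  ultimately have "five_term x y - inversion_sum ?u + inversion_sum ?v
      + inversion_sum ?u - inversion_sum ?v \<in> bar_kernel"
    by (meson bar.add_mem bar.diff_mem)
  then show ?thesis by simp
qed

lemma natural_map_wd:
  shows "\<lbrakk>x \<in> Fflat F; y \<in> Fflat F; x \<noteq> y\<rbrakk> \<Longrightarrow>
      bar_class F (five_term x y) = \<one>\<^bsub>pre_bloch_bar F\<^esub>"
    and "x \<in> Fflat F \<Longrightarrow> bar_class F (frag_of x + frag_of (1 - x)) = \<one>\<^bsub>pre_bloch_bar F\<^esub>"
    and "bar_class F (frag_of x) = bloch_sym_bar F x"
  by (auto intro!: bar_kernelD five_term_bar_kernel complement_sum_bar_kernel
      simp: bloch_sym_bar_eq)

lemmas natural_map_facts = induced_from_pre_bloch_mod_c[OF comm_group_pre_bloch_bar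
  bar_class_group_hom natural_map_wd, folded natural_map_def]

lemma natural_map:
  shows "group_hom (pre_bloch_mod_c F) (pre_bloch_bar F) (natural_map F)"
    and "z \<in> carrier (free_symbols F) \<Longrightarrow> natural_map F (mod_c_class F z) = bar_class F z"
  by (rule natural_map_facts; assumption)+

subsection \<open>The boundary map\<close>

lemma neg_tensor_wedge_kernel: "x \<noteq> 0 \<Longrightarrow> frag_of (x, - x) \<in> wedge_kernel F"
  using wedge.diff_mem[OF wedge.skew[of "- x" x] twisted_diagonal_wedge_kernel[of x F]] by simp

lemma one_minus_tensor_bar_relators:
  assumes "z \<in> bar_relators F" shows "one_minus_tensor z \<in> wedge_kernel F"
proof -
  have "bar_relators F \<subseteq> {z. one_minus_tensor z \<in> wedge_kernel F}"
  proof (rule bar_relators_in_subgroup)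
    show "closed_under_difference {z :: 'a \<Rightarrow>\<^sub>0 int. one_minus_tensor z \<in> wedge_kernel F}"
      by unfold_locales (auto intro: wedge.mem)
    show "inversion_sum x \<in> {z. one_minus_tensor z \<in> wedge_kernel F}" if "x \<noteq> 0" for x
      using wedge.add_mem[OF wedge.one_minus_tensor_inversion_sum[OF that]
          neg_tensor_wedge_kernel[OF that]] by simp
  qed (auto intro!: wedge.one_minus_tensor_five_term wedge.skew simp: Fflat_def)
  with assms show ?thesis by blast
qed

lemma wedge_one_minus_tensor_group_hom:
  "group_hom (free_symbols F) (wedge_square F) (\<lambda>z. wedge_class F (one_minus_tensor z))"
  by (rule group_hom_compose[OF one_minus_tensor_group_hom wedge_square_quotient(2)])

text \<open>
  The sign comes from the order of the factors: \<open>(1 - x) \<otimes> x\<close> is the negative of \<open>x \<otimes> (1 - x)\<close>.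
\<close>
lemma boundary_bar:
  shows "group_hom (pre_bloch_bar F) (wedge_square F) (boundary_bar F)"
    and "z \<in> carrier (free_symbols F) \<Longrightarrow>
      boundary_bar F (bar_class F z) = inv\<^bsub>wedge_square F\<^esub> wedge_class F (one_minus_tensor z)"
proof -
  interpret W: comm_group "wedge_square F" by (rule wedge_square_quotient(1))
  interpret w: group_hom "free_tensors F" "wedge_square F" "wedge_class F"
    by (rule wedge_square_quotient(2))
  let ?f = "\<lambda>x. wedge F (1 - x) x" and ?h = "\<lambda>z. wedge_class F (one_minus_tensor (- z))"
  have h: "group_hom (free_symbols F) (wedge_square F) ?h"
    by (rule group_hom_comp_uminus[OF wedge_one_minus_tensor_group_hom])
  have fc: "?f ` Fflat F \<subseteq> carrier (wedge_square F)"
    by (auto simp: wedge_eq Fflat_def carrier_Funits intro!: w.hom_closed)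
  note hom0 = W.free_ext_group_hom[OF fc]
  have gen: "?f x = ?h (frag_of x)" if "x \<in> Fflat F" for x
  proof -
    have x: "x \<noteq> 0" "1 - x \<noteq> 0" using that by (auto simp: Fflat_def)
    have "wedge_class F (frag_of (1 - x, x) - - frag_of (x, 1 - x)) = \<one>\<^bsub>wedge_square F\<^esub>"
      using wedge_kernelD[OF wedge.skew[OF x(2,1)]] by simp
    then show ?thesis
      using x unfolding wedge_eq
      by (subst (asm) free_Abelian_group_hom_diff[OF wedge_square_quotient(2)])
         (auto simp: carrier_Funits W.inv_solve_right' w.hom_closed)
  qed
  have eq: "free_ext (wedge_square F) ?f z = ?h z" if "z \<in> carrier (free_symbols F)" for z
  proof (rule free_Abelian_group_hom_cong[OF hom0 h])
    show "free_ext (wedge_square F) ?f (frag_of x) = ?h (frag_of x)" if "x \<in> Fflat F" for x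
      using that gen fc W.free_ext_frag_of[of ?f x] by auto
  qed (use that in simp)
  have kills: "free_ext (wedge_square F) ?f s = \<one>\<^bsub>wedge_square F\<^esub>" if "s \<in> bar_relators F" for s
    using eq[OF subsetD[OF bar_relators_carrier that]]
      wedge_kernelD[OF wedge.uminus_mem[OF one_minus_tensor_bar_relators[OF that]]] by simp
  show "group_hom (pre_bloch_bar F) (wedge_square F) (boundary_bar F)"
    unfolding pre_bloch_bar_def boundary_bar_def
    by (rule comm_group.induced_map_group_hom[OF abelian_free_Abelian_group bar_relators_carrier
          hom0 kills])
  show "boundary_bar F (bar_class F z) = inv\<^bsub>wedge_square F\<^esub> wedge_class F (one_minus_tensor z)"
    if "z \<in> carrier (free_symbols F)" for z
    unfolding boundary_bar_def bar_class_def
    using comm_group.induced_map_quotient_class[OF abelian_free_Abelian_group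
        bar_relators_carrier hom0 kills that] eq[OF that] one_minus_tensor_closed[OF that]
      free_Abelian_group_hom_uminus[OF wedge_square_quotient(2), of "one_minus_tensor z"] by simp
qed

end

section \<open>Inversion sums and the isomorphism\<close>

context field_card_ge_4
begin

definition inversion_class :: "'a \<Rightarrow> ('a \<Rightarrow>\<^sub>0 int) set set" where
  "inversion_class x = mod_c_class F (inversion_sum x)"

definition neg_tensor_class :: "'a \<Rightarrow> ('a \<times> 'a \<Rightarrow>\<^sub>0 int) set set" where
  "neg_tensor_class x = sigma_class F (frag_of (x, - x))"

sublocale P: comm_group "pre_bloch_mod_c F" by (rule comm_group_pre_bloch_mod_c)
sublocale T: comm_group "tensor_sigma F" by (rule tensor_sigma_quotient(1))

lemma inversion_class_closed: "x \<noteq> 0 \<Longrightarrow> inversion_class x \<in> carrier (pre_bloch_mod_c F)"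
  unfolding inversion_class_def carrier_pre_bloch_mod_c using inversion_sum_keys by blast

lemma neg_tensor_closed: "x \<noteq> 0 \<Longrightarrow> frag_of (x, - x) \<in> carrier (free_tensors F)"
  by (simp add: carrier_Funits)

lemma neg_tensor_class_closed: "x \<noteq> 0 \<Longrightarrow> neg_tensor_class x \<in> carrier (tensor_sigma F)"
  unfolding neg_tensor_class_def tensor_sigma_quotient(3) using neg_tensor_closed by blast

lemma inversion_class_mult:
  assumes "x \<noteq> 0" "y \<noteq> 0"
  shows "inversion_class (x * y) = inversion_class x \<otimes>\<^bsub>pre_bloch_mod_c F\<^esub> inversion_class y"
  unfolding inversion_class_def
  by (intro free_Abelian_group_hom_mult_cong[OF mod_c_class_group_hom]
      inversion_sum_keys mod_c_kernelD symbols.inversion_sum_mult card assms no_zero_divisors)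

lemma neg_tensor_class_mult:
  assumes "x \<noteq> 0" "y \<noteq> 0"
  shows "neg_tensor_class (x * y) = neg_tensor_class x \<otimes>\<^bsub>tensor_sigma F\<^esub> neg_tensor_class y"
  unfolding neg_tensor_class_def
  by (intro free_Abelian_group_hom_mult_cong[OF tensor_sigma_quotient(2)]
      neg_tensor_closed sigma_kernelD sigma.neg_right_mult assms no_zero_divisors)

lemma carrier_inversion_subgroup:
  "carrier (inversion_subgroup F) = inversion_class ` (- {0})"
proof -
  have "{bloch_sym_mod_c F x \<otimes>\<^bsub>pre_bloch_mod_c F\<^esub> bloch_sym_mod_c F (inverse x) | x. x \<in> Fflat F} =
      inversion_class ` Fflat F"
  proof -
    have "bloch_sym_mod_c F x \<otimes>\<^bsub>pre_bloch_mod_c F\<^esub> bloch_sym_mod_c F (inverse x) = inversion_class x"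
      if "x \<in> Fflat F" for x
      using that unfolding inversion_class_def bloch_sym_mod_c_eq
      by (subst free_Abelian_group_hom_add[OF mod_c_class_group_hom, symmetric])
         (auto simp: inversion_sum_def Fflat_def)
    then show ?thesis by force
  qed
  moreover have "inversion_class ` Fflat F \<subseteq> carrier (pre_bloch_mod_c F)"
    using inversion_class_closed by (auto simp: Fflat_def)
  ultimately show ?thesis
    unfolding inversion_subgroup_def carrier_subgroup_generated
    by (simp add: Int_absorb1 generate_image_Fflat[OF P.is_group inversion_class_closed
          inversion_class_mult])
qed

lemma carrier_negation_subgroup:
  "carrier (negation_subgroup F) = neg_tensor_class ` (- {0})"
proof -
  have "{tens_sigma F x (- x) | x. x \<in> Fflat F} = neg_tensor_class ` Fflat F"
    by (auto simp: tens_sigma_eq neg_tensor_class_def)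
  moreover have "neg_tensor_class ` Fflat F \<subseteq> carrier (tensor_sigma F)"
    using neg_tensor_class_closed by (auto simp: Fflat_def)
  ultimately show ?thesis
    unfolding negation_subgroup_def carrier_subgroup_generated
    by (simp add: Int_absorb1 generate_image_Fflat[OF T.is_group neg_tensor_class_closed
          neg_tensor_class_mult])
qed

lemma suslin_map_inversion_class:
  assumes "x \<noteq> 0"
  shows "suslin_map_mod_c F (inversion_class x) = neg_tensor_class x"
proof -
  have "sigma_class F (one_minus_tensor (inversion_sum x) - frag_of (x, - x)) = \<one>\<^bsub>tensor_sigma F\<^esub>"
    by (intro sigma_kernelD sigma.one_minus_tensor_inversion_sum assms)
  then have "sigma_class F (one_minus_tensor (inversion_sum x) - frag_of (x, - x) - 0) = \<one>\<^bsub>tensor_sigma F\<^esub>"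
    by simp
  then have "sigma_class F (one_minus_tensor (inversion_sum x)) =
      sigma_class F (frag_of (x, - x)) \<otimes>\<^bsub>tensor_sigma F\<^esub> sigma_class F 0"
    by (intro free_Abelian_group_hom_mult_cong[OF tensor_sigma_quotient(2)]
         one_minus_tensor_closed inversion_sum_keys neg_tensor_closed assms) auto
  moreover have "sigma_class F 0 = \<one>\<^bsub>tensor_sigma F\<^esub>"
    using group_hom.hom_one[OF tensor_sigma_quotient(2)] by simp
  ultimately show ?thesis
    using suslin_map(4)[OF inversion_sum_keys[OF assms]] neg_tensor_class_closed[OF assms]
    by (simp add: inversion_class_def neg_tensor_class_def)
qed

text \<open>
  The heart of injectivity: \<open>x \<otimes> (-x)\<close> vanishes only for \<open>x = \<plusminus> y\<^sup>2\<close>, and for these \<open>x\<close> the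
  inversion sum vanishes as well.
\<close>
lemma inversion_class_eq_one:
  assumes "x \<noteq> 0" "neg_tensor_class x = \<one>\<^bsub>tensor_sigma F\<^esub>"
  shows "inversion_class x = \<one>\<^bsub>pre_bloch_mod_c F\<^esub>"
proof -
  have "frag_of (x, - x) \<in> sigma_kernel F"
    using assms neg_tensor_closed by (simp add: sigma_kernel_def kernel_def neg_tensor_class_def)
  then obtain y where "y \<noteq> 0" "x = y * y \<or> x = - (y * y)"
    using neg_tensor_in_sigma_kernel assms(1) by blast
  then show ?thesis
    unfolding inversion_class_def by (intro mod_c_kernelD symbols.inversion_sum_square)
qed

lemma suslin_map_hom:
  "suslin_map_mod_c F \<in> hom (inversion_subgroup F) (negation_subgroup F)"
proof (rule homI)
  interpret d: group_hom "pre_bloch_mod_c F" "tensor_sigma F" "suslin_map_mod_c F"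
    by (rule suslin_map(3))
  show "suslin_map_mod_c F z \<in> carrier (negation_subgroup F)"
    if "z \<in> carrier (inversion_subgroup F)" for z
    using that by (auto simp: carrier_inversion_subgroup carrier_negation_subgroup
        suslin_map_inversion_class)
  show "suslin_map_mod_c F (z \<otimes>\<^bsub>inversion_subgroup F\<^esub> w) =
      suslin_map_mod_c F z \<otimes>\<^bsub>negation_subgroup F\<^esub> suslin_map_mod_c F w"
    if "z \<in> carrier (inversion_subgroup F)" "w \<in> carrier (inversion_subgroup F)" for z w
    using that inversion_class_closed unfolding carrier_inversion_subgroup
    by (auto simp: inversion_subgroup_def negation_subgroup_def subgroup_generated_def)
qed

lemma suslin_map_bij:
  "bij_betw (suslin_map_mod_c F) (carrier (inversion_subgroup F)) (carrier (negation_subgroup F))"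
  unfolding bij_betw_def
proof
  show "suslin_map_mod_c F ` carrier (inversion_subgroup F) = carrier (negation_subgroup F)"
    by (simp add: carrier_inversion_subgroup carrier_negation_subgroup image_image
        suslin_map_inversion_class)
  show "inj_on (suslin_map_mod_c F) (carrier (inversion_subgroup F))"
    unfolding carrier_inversion_subgroup
  proof (rule inj_onI)
    fix a b assume ab: "a \<in> inversion_class ` (- {0})" "b \<in> inversion_class ` (- {0})"
      and "suslin_map_mod_c F a = suslin_map_mod_c F b"
    moreover obtain x y where xy: "x \<noteq> 0" "y \<noteq> 0" "a = inversion_class x" "b = inversion_class y"
      using ab by auto
    ultimately have eq: "neg_tensor_class x = neg_tensor_class y"
      by (simp add: suslin_map_inversion_class)
    have q: "x / y \<noteq> 0" "x / y * y = x" using xy by simp_all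
    have "neg_tensor_class (x / y) \<otimes>\<^bsub>tensor_sigma F\<^esub> neg_tensor_class y = neg_tensor_class y"
      using neg_tensor_class_mult[OF q(1) xy(2)] eq q(2) by simp
    then have "neg_tensor_class (x / y) = \<one>\<^bsub>tensor_sigma F\<^esub>"
      using T.r_cancel_one neg_tensor_class_closed q(1) xy(2) by blast
    from inversion_class_eq_one[OF q(1) this]
    show "a = b"
      using inversion_class_mult[OF q(1) xy(2)] inversion_class_closed[OF xy(2)] q(2) xy(3,4)
      by simp
  qed
qed

text \<open>
  The representatives whose class lies in the inversion subgroup form a group containing all relators
  of the modified group.
\<close>
lemma kernel_natural_map:
  "kernel (pre_bloch_mod_c F) (pre_bloch_bar F) (natural_map F) = carrier (inversion_subgroup F)"
proof
  let ?Q = "mod_c_class F"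
  interpret Q: group_hom "free_symbols F" "pre_bloch_mod_c F" ?Q by (rule mod_c_class_group_hom)
  have I_sub: "carrier (inversion_subgroup F) \<subseteq> carrier (pre_bloch_mod_c F)"
    unfolding carrier_inversion_subgroup using inversion_class_closed by auto
  have I_subgroup: "subgroup (carrier (inversion_subgroup F)) (pre_bloch_mod_c F)"
    unfolding inversion_subgroup_def carrier_subgroup_generated
    by (rule P.generate_is_subgroup) simp
  define M where "M = {z \<in> carrier (free_symbols F). ?Q z \<in> carrier (inversion_subgroup F)}"
  have M_mem: "z \<in> M" if "z \<in> mod_c_kernel" for z
    using that subgroup.one_closed[OF I_subgroup] by (simp add: M_def mod_c_kernel_def kernel_def)
  have M_group: "closed_under_difference M"
  proof
    show "0 \<in> M" by (rule M_mem[OF symbols.zero_mem])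
    show "z - w \<in> M" if "z \<in> M" "w \<in> M" for z w
      using that Poly_Mapping.keys_diff[of z w] I_subgroup
      by (auto simp: M_def free_Abelian_group_hom_diff[OF mod_c_class_group_hom]
          intro!: subgroup.m_closed subgroup.m_inv_closed)
  qed
  then interpret M: closed_under_difference M .
  have "bar_relators F \<subseteq> M"
  proof (rule bar_relators_in_subgroup[OF M_group])
    show "inversion_sum x \<in> M" if "x \<noteq> 0" for x
      using that inversion_sum_keys[OF that, of F]
      by (auto simp: M_def carrier_inversion_subgroup inversion_class_def)
  qed (auto intro!: M_mem symbols.five_term symbols.complement_sum simp: Fflat_def)
  moreover have "subgroup M (free_symbols F)"
  proof (rule group.subgroupI[OF group_free_Abelian_group])
    show "M \<subseteq> carrier (free_symbols F)" by (auto simp: M_def)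
    then show "inv\<^bsub>free_symbols F\<^esub> z \<in> M" if "z \<in> M" for z
      using that M.uminus_mem by (auto simp: subset_iff)
  qed (use M.zero_mem M.add_mem in auto)
  ultimately have gen: "generate (free_symbols F) (bar_relators F) \<subseteq> M"
    by (intro group.generate_subgroup_incl[OF group_free_Abelian_group])
  show "kernel (pre_bloch_mod_c F) (pre_bloch_bar F) (natural_map F) \<subseteq> carrier (inversion_subgroup F)"
  proof
    fix a assume a: "a \<in> kernel (pre_bloch_mod_c F) (pre_bloch_bar F) (natural_map F)"
    then obtain z where z: "z \<in> carrier (free_symbols F)" "a = ?Q z"
      by (auto simp: kernel_def carrier_pre_bloch_mod_c)
    then have "bar_class F z = \<one>\<^bsub>pre_bloch_bar F\<^esub>"
      using a by (simp add: kernel_def natural_map(2))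
    then have "z \<in> M" using gen bar_class_eq_one_iff[OF z(1)] by blast
    then show "a \<in> carrier (inversion_subgroup F)" using z by (simp add: M_def)
  qed
  show "carrier (inversion_subgroup F) \<subseteq> kernel (pre_bloch_mod_c F) (pre_bloch_bar F) (natural_map F)"
  proof
    fix a assume "a \<in> carrier (inversion_subgroup F)"
    then obtain x where x: "x \<noteq> 0" "a = inversion_class x"
      by (auto simp: carrier_inversion_subgroup)
    then show "a \<in> kernel (pre_bloch_mod_c F) (pre_bloch_bar F) (natural_map F)"
      using inversion_class_closed[OF x(1)] natural_map(2)[OF inversion_sum_keys[OF x(1)]]
        bar_kernelD[OF inversion_sum_bar_kernel[OF x(1)]]
      by (simp add: kernel_def inversion_class_def)
  qed
qed

definition wedge_projection :: "('a \<times> 'a \<Rightarrow>\<^sub>0 int) set set \<Rightarrow> ('a \<times> 'a \<Rightarrow>\<^sub>0 int) set set" where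
  "wedge_projection = induced_map (quotient_class (tensor_square F) (wedge_relators F))"

lemma wedge_projection:
  shows "group_hom (tensor_sigma F) (wedge_square F) wedge_projection"
    and "z \<in> carrier (free_tensors F) \<Longrightarrow> wedge_projection (sigma_class F z) = wedge_class F z"
proof -
  interpret comm_group "tensor_square F" by (rule comm_group_tensor_square)
  have S: "sigma_relators F \<subseteq> carrier (tensor_square F)"
    unfolding sigma_relators_eq by (rule tensor_class_closed[OF skew_relators_carrier])
  have W: "wedge_relators F \<subseteq> carrier (tensor_square F)"
    unfolding wedge_relators_eq by (rule tensor_class_closed[OF twisted_diagonal_carrier])
  have h: "group_hom (tensor_square F) (wedge_square F) (quotient_class (tensor_square F) (wedge_relators F))"
    unfolding wedge_square_def by (rule quotient_class_group_hom[OF W])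
  have kills: "quotient_class (tensor_square F) (wedge_relators F) s = \<one>\<^bsub>wedge_square F\<^esub>"
    if "s \<in> sigma_relators F" for s
    using that wedge_kernelD[OF wedge.skew]
    by (auto simp: sigma_relators_eq skew_relators_def wedge_class_def)
  show "group_hom (tensor_sigma F) (wedge_square F) wedge_projection"
    unfolding tensor_sigma_def wedge_projection_def by (rule induced_map_group_hom[OF S h kills])
  show "wedge_projection (sigma_class F z) = wedge_class F z" if "z \<in> carrier (free_tensors F)"
  proof -
    have "tensor_class F z \<in> carrier (tensor_square F)"
      using that unfolding tensor_class_image by blast
    from induced_map_quotient_class[OF S h kills this]
    show ?thesis by (simp add: wedge_projection_def sigma_class_def wedge_class_def)
  qed
qed

text \<open>
  The representatives whose class lies in the negation subgroup form a group containing the tensor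
  relators and all \<open>(-x) \<otimes> x\<close>; the latter belong to it as the generator attached to \<open>-x\<close>.
\<close>
lemma kernel_wedge_projection:
  "kernel (tensor_sigma F) (wedge_square F) wedge_projection = carrier (negation_subgroup F)"
proof
  let ?S = "sigma_class F"
  have N_subgroup: "subgroup (carrier (negation_subgroup F)) (tensor_sigma F)"
    unfolding negation_subgroup_def carrier_subgroup_generated
    by (rule T.generate_is_subgroup) simp
  have "subgroup {z \<in> carrier (free_tensors F). ?S z \<in> carrier (negation_subgroup F)} (free_tensors F)"
    (is "subgroup ?M _")
  proof (rule group.subgroupI[OF group_free_Abelian_group])
    show "?M \<noteq> {}"
      using subgroup.one_closed[OF N_subgroup] group_hom.hom_one[OF tensor_sigma_quotient(2), of F]
      by (auto intro!: exI[of _ 0])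
    show "inv\<^bsub>free_tensors F\<^esub> z \<in> ?M" if "z \<in> ?M" for z
      using that subgroup.m_inv_closed[OF N_subgroup]
      by (auto simp: free_Abelian_group_hom_uminus[OF tensor_sigma_quotient(2)])
    show "z \<otimes>\<^bsub>free_tensors F\<^esub> w \<in> ?M" if "z \<in> ?M" "w \<in> ?M" for z w
      using that subgroup.m_closed[OF N_subgroup] Poly_Mapping.keys_add[of z w]
      by (auto simp: free_Abelian_group_hom_add[OF tensor_sigma_quotient(2)])
  qed auto
  moreover have "tensor_relators (Funits F) (Funits F) \<union> twisted_diagonal F \<subseteq> ?M"
  proof
    fix z assume "z \<in> tensor_relators (Funits F) (Funits F) \<union> twisted_diagonal F"
    then consider "z \<in> tensor_relators (Funits F) (Funits F)" | x where "x \<noteq> 0" "z = frag_of (- x, x)"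
      by (auto simp: twisted_diagonal_def)
    then show "z \<in> ?M"
    proof cases
      case 1
      then have "z \<in> sigma_kernel F"
        unfolding sigma_kernel_def tensor_sigma_quotient(4) by (intro generate.incl) simp
      then show ?thesis
        using subgroup.one_closed[OF N_subgroup] by (simp add: sigma_kernel_def kernel_def)
    next
      case (2 x)
      then have "?S z = neg_tensor_class (- x)" by (simp add: neg_tensor_class_def)
      with 2 show ?thesis
        unfolding carrier_negation_subgroup by (auto simp: carrier_Funits)
    qed
  qed
  ultimately have gen: "generate (free_tensors F)
      (tensor_relators (Funits F) (Funits F) \<union> twisted_diagonal F) \<subseteq> ?M"
    by (intro group.generate_subgroup_incl[OF group_free_Abelian_group])
  show "kernel (tensor_sigma F) (wedge_square F) wedge_projection \<subseteq> carrier (negation_subgroup F)"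
  proof
    fix a assume a: "a \<in> kernel (tensor_sigma F) (wedge_square F) wedge_projection"
    then obtain z where z: "z \<in> carrier (free_tensors F)" "a = ?S z"
      by (auto simp: kernel_def tensor_sigma_quotient(3))
    then have "z \<in> kernel (free_tensors F) (wedge_square F) (wedge_class F)"
      using a by (simp add: kernel_def wedge_projection(2))
    then have "z \<in> ?M" unfolding wedge_square_quotient(4) using gen by blast
    with z show "a \<in> carrier (negation_subgroup F)" by simp
  qed
  show "carrier (negation_subgroup F) \<subseteq> kernel (tensor_sigma F) (wedge_square F) wedge_projection"
  proof
    fix a assume "a \<in> carrier (negation_subgroup F)"
    then obtain x where x: "x \<noteq> 0" "a = neg_tensor_class x"
      by (auto simp: carrier_negation_subgroup)
    then show "a \<in> kernel (tensor_sigma F) (wedge_square F) wedge_projection"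
      using neg_tensor_class_closed[OF x(1)] wedge_projection(2)[OF neg_tensor_closed[OF x(1)]]
        wedge_kernelD[OF neg_tensor_wedge_kernel[OF x(1)]]
      by (simp add: kernel_def neg_tensor_class_def)
  qed
qed

text \<open>
  Passing to the kernel of \<^term>\<open>suslin_map F\<close> commutes with dividing out \<open>c\<^sub>F\<close>, because \<open>c\<^sub>F\<close> lies in
  that kernel.
\<close>
lemma carrier_bloch_mod_c:
  "carrier (bloch_mod_c F) = kernel (pre_bloch_mod_c F) (tensor_sigma F) (suslin_map_mod_c F)"
  and mult_bloch_mod_c: "monoid.mult (bloch_mod_c F) = monoid.mult (pre_bloch_mod_c F)"
proof -
  interpret s: group_hom "pre_bloch F" "tensor_sigma F" "suslin_map F" by (rule suslin_map(1))
  let ?B = "kernel (pre_bloch F) (tensor_sigma F) (suslin_map F)"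
  have c: "{c_elem F} \<subseteq> ?B" using c_elem_closed suslin_map(5) by (simp add: kernel_def)
  have gen: "generate (bloch F) {c_elem F} = generate (pre_bloch F) {c_elem F}"
    unfolding bloch_def by (rule s.G.generate_consistent[OF c s.subgroup_kernel])
  have class_eq: "quotient_class (bloch F) {c_elem F} b = quotient_class (pre_bloch F) {c_elem F} b" for b
    unfolding quotient_class_def gen by (simp add: r_coset_def bloch_def)
  have on_class: "suslin_map_mod_c F (quotient_class (pre_bloch F) {c_elem F} b) = suslin_map F b"
    if b: "b \<in> carrier (pre_bloch F)" for b
  proof -
    obtain z where z: "z \<in> carrier (free_symbols F)" "b = suslin_class F z"
      using b unfolding carrier_pre_bloch by blast
    then show ?thesis
      using suslin_map(2,4)[OF z(1)] by (simp add: mod_c_class_def)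
  qed
  have "carrier (bloch_mod_c F) = quotient_class (pre_bloch F) {c_elem F} ` ?B"
    by (simp add: bloch_mod_c_def quotient_by_def carrier_FactGroup class_eq[unfolded quotient_class_def]
        quotient_class_def) (simp add: bloch_def)
  also have "\<dots> = kernel (pre_bloch_mod_c F) (tensor_sigma F) (suslin_map_mod_c F)"
    using on_class by (fastforce simp: kernel_def pre_bloch_mod_c_def
        comm_group.carrier_quotient_by[OF comm_group_pre_bloch])
  finally show "carrier (bloch_mod_c F) =
      kernel (pre_bloch_mod_c F) (tensor_sigma F) (suslin_map_mod_c F)" .
  show "monoid.mult (bloch_mod_c F) = monoid.mult (pre_bloch_mod_c F)"
    by (intro ext) (simp add: bloch_mod_c_def pre_bloch_mod_c_def quotient_by_def set_mult_def bloch_def)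
qed

lemma natural_map_iso: "natural_map F \<in> iso (bloch_mod_c F) (bloch_bar F)"
proof -
  have surj: "natural_map F ` carrier (pre_bloch_mod_c F) = carrier (pre_bloch_bar F)"
    unfolding carrier_pre_bloch_mod_c carrier_pre_bloch_bar image_image
    by (rule image_cong) (simp_all add: natural_map(2))
  have comm: "boundary_bar F (natural_map F a) = \<one>\<^bsub>wedge_square F\<^esub> \<longleftrightarrow>
      wedge_projection (suslin_map_mod_c F a) = \<one>\<^bsub>wedge_square F\<^esub>"
    if "a \<in> carrier (pre_bloch_mod_c F)" for a
  proof -
    interpret W: comm_group "wedge_square F" by (rule wedge_square_quotient(1))
    obtain z where z: "z \<in> carrier (free_symbols F)" "a = mod_c_class F z"
      using \<open>a \<in> carrier (pre_bloch_mod_c F)\<close> unfolding carrier_pre_bloch_mod_c by blast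
    have "wedge_class F (one_minus_tensor z) \<in> carrier (wedge_square F)"
      using group_hom.hom_closed[OF wedge_square_quotient(2) one_minus_tensor_closed[OF z(1)]] .
    then show ?thesis
      using z suslin_map(4)[OF z(1)] natural_map(2)[OF z(1)] boundary_bar(2)[OF z(1)]
        wedge_projection(2)[OF one_minus_tensor_closed[OF z(1)]]
      by (simp add: W.inv_eq_1_iff)
  qed
  have "natural_map F \<in> iso
      (pre_bloch_mod_c F\<lparr>carrier := kernel (pre_bloch_mod_c F) (tensor_sigma F) (suslin_map_mod_c F)\<rparr>)
      (pre_bloch_bar F\<lparr>carrier := kernel (pre_bloch_bar F) (wedge_square F) (boundary_bar F)\<rparr>)"
    by (rule iso_between_kernels[OF suslin_map(3) natural_map(1) wedge_projection(1)
          boundary_bar(1) surj _ comm])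
       (simp add: kernel_natural_map kernel_wedge_projection suslin_map_bij)
  then show ?thesis
    by (simp add: iso_def hom_def bloch_bar_def carrier_bloch_mod_c mult_bloch_mod_c)
qed

end

theorem theorem3p23:
  fixes F :: "'a::field itself"
  assumes "infinite (UNIV :: 'a set) \<or> card (UNIV :: 'a set) \<ge> 4"
  shows "suslin_map_mod_c F \<in> hom (inversion_subgroup F) (negation_subgroup F) \<and>
         bij_betw (suslin_map_mod_c F)
           (carrier (inversion_subgroup F)) (carrier (negation_subgroup F)) \<and>
         natural_map F \<in> iso (bloch_mod_c F) (bloch_bar F)"
proof -
  interpret field_card_ge_4 F by unfold_locales (rule assms)
  show ?thesis using suslin_map_hom suslin_map_bij natural_map_iso by blast
qed

end
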